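(* Fix integers $d,r\ge 0$. For every sequence $\alpha=(\alpha_1,\dots,\alpha_d)$ of nonnegative integers with $\alpha_1+\dots+\alpha_d=r$, let $c_\alpha$ be the function on polymatroids $\mathrm{rk}$ on $[d]$ of rank $r$ given by $$c_\alpha(\mathrm{rk})=\#\{\text{maximal chains }\emptyset=X_0\subset X_1\subset\cdots\subset X_d=[d]\ :\ \mathrm{rk}(X_j)-\mathrm{rk}(X_{j-1})=\alpha_j\text{ for }j=1,\dots,d\}.$$ (These are the coefficients of the invariant $\mathcal G(\mathrm{rk})=\sum_{\underline X}U_{r(\underline X)}$, where $r(\underline X)=(\mathrm{rk}(X_1)-\mathrm{rk}(X_0),\dots,\mathrm{rk}(X_d)-\mathrm{rk}(X_{d-1}))$, with respect to a basis $\{U_\alpha\}$ indexed by such sequences.) Then the $\mathbb Q$-linear span of the functions $c_\alpha$ (restricted to $S_{\mathrm{PM}}(d,r)$) is the $\mathbb Q$-vector space of all $\mathbb Q$-valued valuative polymatroid invariants on $S_{\mathrm{PM}}(d,r)$; and likewise the span of the restrictions of the $c_\alpha$ to $S_{\mathrm M}(d,r)$ is the $\mathbb Q$-vector space of all $\mathbb Q$-valued valuative matroid invariants on $S_{\mathrm M}(d,r)$.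
   Context: Write $[d]=\{1,\dots,d\}$. A polymatroid on $[d]$ is a function $\mathrm{rk}:2^{[d]}\to\{0,1,2,\dots\}$ with $\mathrm{rk}(\emptyset)=0$, $\mathrm{rk}(A)\le\mathrm{rk}(B)$ for $A\subseteq B$, and $\mathrm{rk}(A\cup B)+\mathrm{rk}(A\cap B)\le\mathrm{rk}(A)+\mathrm{rk}(B)$ for all $A,B$; it is a matroid if moreover $\mathrm{rk}(\{i\})\le1$ for all $i$. Its rank is $\mathrm{rk}([d])$. $S_{\mathrm{PM}}(d,r)$ (resp. $S_{\mathrm M}(d,r)$) is the set of polymatroids (resp. matroids) on $[d]$ of rank $r$. The base polytope is $Q(\mathrm{rk})=\{y\in\mathbb R^d:\sum_{i=1}^d y_i=\mathrm{rk}([d]),\ \sum_{i\in A}y_i\le\mathrm{rk}(A)\ \forall A\subseteq[d]\}$, and $[\Pi]:\mathbb R^d\to\mathbb Z$ denotes the indicator function of a set $\Pi$. $P_{\mathrm{PM}}(d,r)$ (resp. $P_{\mathrm M}(d,r)$) is the $\mathbb Z$-module of functions $\mathbb R^d\to\mathbb Z$ generated by all $[Q(\mathrm{rk})]$ with $\mathrm{rk}\in S_{\mathrm{PM}}(d,r)$ (resp. $S_{\mathrm M}(d,r)$). A function $f$ on $S_{\mathrm{PM}}(d,r)$ (resp. $S_{\mathrm M}(d,r)$) with values in an abelian group $A$ is valuative if there is a group homomorphism $\hat f$ from $P_{\mathrm{PM}}(d,r)$ (resp. $P_{\mathrm M}(d,r)$) to $A$ with $f(\mathrm{rk})=\hat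 f([Q(\mathrm{rk})])$ for all $\mathrm{rk}$. It is an invariant if $f(\mathrm{rk}\circ\sigma)=f(\mathrm{rk})$ for every permutation $\sigma$ of $[d]$, where $(\mathrm{rk}\circ\sigma)(A)=\mathrm{rk}(\sigma(A))$. *)

theory Defs
  imports
    Complex_Main
    "HOL-Library.FuncSet"
    "HOL-Library.Function_Algebras"
    "HOL-Library.Indicator_Function"
    "HOL-Combinatorics.Permutations"
begin

text \<open>
  The ground set is \<open>{1..d}\<close>. A function on its power set is represented by a function on
  all of \<open>nat set\<close> that is extensional on \<open>Pow {1..d}\<close>, so that equality of
  representatives is equality of functions on the power set.
\<close>

definition polymatroid :: "nat \<Rightarrow> (nat set \<Rightarrow> nat) \<Rightarrow> bool" where
  "polymatroid d rk \<longleftrightarrow>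
     rk \<in> extensional (Pow {1..d}) \<and>
     rk {} = 0 \<and>
     (\<forall>A B. A \<subseteq> B \<and> B \<subseteq> {1..d} \<longrightarrow> rk A \<le> rk B) \<and>
     (\<forall>A B. A \<subseteq> {1..d} \<and> B \<subseteq> {1..d} \<longrightarrow> rk (A \<union> B) + rk (A \<inter> B) \<le> rk A + rk B)"

definition matroid :: "nat \<Rightarrow> (nat set \<Rightarrow> nat) \<Rightarrow> bool" where
  "matroid d rk \<longleftrightarrow> polymatroid d rk \<and> (\<forall>i\<in>{1..d}. rk {i} \<le> 1)"

definition polymatroids :: "nat \<Rightarrow> nat \<Rightarrow> (nat set \<Rightarrow> nat) set" where
  "polymatroids d r = {rk. polymatroid d rk \<and> rk {1..d} = r}"

definition matroids :: "nat \<Rightarrow> nat \<Rightarrow> (nat set \<Rightarrow> nat) set" where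
  "matroids d r = {rk. matroid d rk \<and> rk {1..d} = r}"

text \<open>The space $\mathbb R^d$ is \<open>{1..d} \<rightarrow>\<^sub>E UNIV\<close>.\<close>

definition base_polytope :: "nat \<Rightarrow> (nat set \<Rightarrow> nat) \<Rightarrow> (nat \<Rightarrow> real) set" where
  "base_polytope d rk =
     {y \<in> {1..d} \<rightarrow>\<^sub>E UNIV.
        (\<Sum>i\<in>{1..d}. y i) = real (rk {1..d}) \<and>
        (\<forall>A. A \<subseteq> {1..d} \<longrightarrow> (\<Sum>i\<in>A. y i) \<le> real (rk A))}"

interpretation int_fun: module "\<lambda>(c::int) (f::'b \<Rightarrow> int) x. c * f x"
  by unfold_locales (auto simp: fun_eq_iff algebra_simps)

interpretation rat_fun: vector_space "\<lambda>(c::rat) (f::'b \<Rightarrow> rat) x. c * f x"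
  by unfold_locales (auto simp: fun_eq_iff algebra_simps)

text \<open>
  All indicator functions below vanish outside \<open>{1..d} \<rightarrow>\<^sub>E UNIV\<close>, so their span in
  \<open>(nat \<Rightarrow> real) \<Rightarrow> int\<close> is the module they generate in the functions on $\mathbb R^d$.
\<close>

definition indicator_module ::
    "nat \<Rightarrow> (nat set \<Rightarrow> nat) set \<Rightarrow> ((nat \<Rightarrow> real) \<Rightarrow> int) set" where
  "indicator_module d S = int_fun.span ((\<lambda>rk. indicator (base_polytope d rk)) ` S)"

definition valuative ::
    "nat \<Rightarrow> (nat set \<Rightarrow> nat) set \<Rightarrow> ((nat set \<Rightarrow> nat) \<Rightarrow> 'a::ab_group_add) \<Rightarrow> bool" where
  "valuative d S f \<longleftrightarrow>
     (\<exists>F :: ((nat \<Rightarrow> real) \<Rightarrow> int) \<Rightarrow> 'a.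
        (\<forall>g\<in>indicator_module d S. \<forall>h\<in>indicator_module d S. F (g + h) = F g + F h) \<and>
        (\<forall>rk\<in>S. f rk = F (indicator (base_polytope d rk))))"

text \<open>
  A permutation of \<open>{1..d}\<close> fixes everything outside \<open>{1..d}\<close>, so \<open>\<lambda>A. rk (\<sigma> ` A)\<close> is again
  extensional.
\<close>

definition is_invariant ::
    "nat \<Rightarrow> (nat set \<Rightarrow> nat) set \<Rightarrow> ((nat set \<Rightarrow> nat) \<Rightarrow> 'a) \<Rightarrow> bool" where
  "is_invariant d S f \<longleftrightarrow>
     (\<forall>rk\<in>S. \<forall>\<sigma>. \<sigma> permutes {1..d} \<longrightarrow> f (\<lambda>A. rk (\<sigma> ` A)) = f rk)"

text \<open>
  A rational function on \<open>S\<close> is represented by its extension by zero, which makes the functions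
  on \<open>S\<close> a subspace of the functions on the whole type.
\<close>

definition valuative_invariants ::
    "nat \<Rightarrow> (nat set \<Rightarrow> nat) set \<Rightarrow> ((nat set \<Rightarrow> nat) \<Rightarrow> rat) set" where
  "valuative_invariants d S =
     {f. (\<forall>rk. rk \<notin> S \<longrightarrow> f rk = 0) \<and> valuative d S f \<and> is_invariant d S f}"

definition restrict_zero :: "'b set \<Rightarrow> ('b \<Rightarrow> rat) \<Rightarrow> 'b \<Rightarrow> rat" where
  "restrict_zero S f = (\<lambda>x. if x \<in> S then f x else 0)"

text \<open>The chain \<open>X\<^sub>0 \<subset> \<dots> \<subset> X\<^sub>d\<close> is the list \<open>[X\<^sub>0, \<dots>, X\<^sub>d]\<close>.\<close>

definition maximal_chains :: "nat \<Rightarrow> nat set list set" where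
  "maximal_chains d =
     {X. length X = d + 1 \<and> X ! 0 = {} \<and> X ! d = {1..d} \<and>
         (\<forall>j\<in>{1..d}. X ! (j - 1) \<subset> X ! j)}"

definition weak_compositions :: "nat \<Rightarrow> nat \<Rightarrow> (nat \<Rightarrow> nat) set" where
  "weak_compositions d r = {\<alpha> \<in> {1..d} \<rightarrow>\<^sub>E UNIV. (\<Sum>j\<in>{1..d}. \<alpha> j) = r}"

definition G_coeff :: "nat \<Rightarrow> (nat \<Rightarrow> nat) \<Rightarrow> (nat set \<Rightarrow> nat) \<Rightarrow> rat" where
  "G_coeff d \<alpha> rk =
     of_nat (card {X \<in> maximal_chains d.
       \<forall>j\<in>{1..d}. int (rk (X ! j)) - int (rk (X ! (j - 1))) = int (\<alpha> j)})"

end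

theory Submission
  imports Defs "HOL-Analysis.Analysis"
begin

text \<open>
  A function on the finite set of (poly)matroids is valuative iff it annihilates every integer
  relation between indicator functions of base polytopes. Such relations are the same as the
  integer combinations that, for every maximal chain, cancel on each class of polymatroids with
  prescribed ranks along the chain. In one direction, prescribing the ranks along a chain amounts to
  comparing whether the polytope meets two convex sets, and nonemptiness of compact convex sets is a
  valuation (the Euler characteristic). In the other direction, inclusion-exclusion over chains of
  violated inequalities expresses the indicator function of a base polytope through the ranks along
  chains. Hence each \<open>G_coeff\<close> is valuative. Conversely, if a valuative invariant \<open>f\<close> were not in
  their span, some integer combination would annihilate all \<open>G_coeff\<close> but not \<open>f\<close>; its
  symmetrisation is a relation between indicator functions, which \<open>f\<close> annihilates.
\<close>

section \<open>The Euler characteristic of compact convex sets\<close>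

text \<open>Moving right from \<open>t\<close>, the indicator of a nonempty compact interval changes
  only if \<open>t\<close> is its right end point, and then it drops by 1. The relation therefore
  splits by right end points, each of which carries total weight zero.\<close>

lemma compact_interval_relation:
  fixes J :: "'i \<Rightarrow> real set" and m :: "'i \<Rightarrow> int"
  assumes fin: "finite I"
    and comp: "\<And>i. i \<in> I \<Longrightarrow> compact (J i)" and conv: "\<And>i. i \<in> I \<Longrightarrow> is_interval (J i)"
    and rel: "\<And>t. (\<Sum>i\<in>I. m i * of_bool (t \<in> J i)) = 0"
  shows "(\<Sum>i\<in>I. m i * of_bool (J i \<noteq> {})) = 0"
proof -
  define I' where "I' = {i \<in> I. J i \<noteq> {}}"
  have fin': "finite I'" using fin by (simp add: I'_def)
  have "\<exists>a b. J i = {a..b} \<and> a \<le> b" if "i \<in> I'" for i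
  proof -
    have "i \<in> I" "J i \<noteq> {}" using that by (auto simp: I'_def)
    then obtain a b where "J i = {a..b}"
      using comp conv is_interval_compact[of "J i"] by auto
    then show ?thesis using \<open>J i \<noteq> {}\<close> by auto
  qed
  then obtain a b where ab: "\<And>i. i \<in> I' \<Longrightarrow> J i = {a i..b i} \<and> a i \<le> b i"
    by metis
  have rel': "(\<Sum>i\<in>I'. m i * of_bool (t \<in> J i)) = 0" for t
    using rel[of t] by (subst sum.mono_neutral_left[of I]) (auto simp: I'_def fin)
  \<comment> \<open>Compare the relation at \<open>t\<close> with the one immediately to the right of \<open>t\<close>.\<close>
  have key: "(\<Sum>i\<in>{i\<in>I'. b i = t}. m i) = 0" for t
  proof -
    have "\<forall>\<^sub>F s in at_right t. \<forall>c\<in>a ` I' \<union> b ` I'. t < c \<longrightarrow> s < c"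
    proof (intro eventually_ball_finite ballI)
      show "\<forall>\<^sub>F s in at_right t. t < c \<longrightarrow> s < c" for c
        using order_tendstoD(2)[OF tendsto_ident_at[of t "{t<..}"], of c]
        by (cases "t < c") auto
    qed (use fin' in auto)
    then have "\<forall>\<^sub>F s in at_right t. t < s \<and> (\<forall>c\<in>a ` I' \<union> b ` I'. t < c \<longrightarrow> s < c)"
      by (intro eventually_conj eventually_at_right_less)
    then obtain s where s: "t < s" "\<And>c. c \<in> a ` I' \<union> b ` I' \<Longrightarrow> t < c \<Longrightarrow> s < c"
      using eventually_happens'[OF trivial_limit_at_right_real] by blast
    \<comment> \<open>No end point lies in the half-open interval from \<open>t\<close> (excluded)
      to \<open>s\<close> (included), so only intervals ending at \<open>t\<close> tell the two
      points apart.\<close>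
    have eq: "m i * of_bool (t \<in> J i) - m i * of_bool (s \<in> J i) = (if b i = t then m i else 0)"
      if "i \<in> I'" for i
      using ab[OF that] s(1) s(2)[of "a i"] s(2)[of "b i"] that by (auto simp: of_bool_def)
    have "0 = (\<Sum>i\<in>I'. m i * of_bool (t \<in> J i) - m i * of_bool (s \<in> J i))"
      by (simp add: sum_subtractf rel')
    also have "\<dots> = (\<Sum>i\<in>{i\<in>I'. b i = t}. m i)"
      using fin' eq by (simp add: sum.inter_filter)
    finally show ?thesis by simp
  qed
  have "(\<Sum>i\<in>I. m i * of_bool (J i \<noteq> {})) = (\<Sum>i\<in>I'. m i)"
    using fin by (simp add: I'_def sum.inter_filter of_bool_def if_distrib cong: if_cong)
  also have "\<dots> = (\<Sum>t\<in>b ` I'. \<Sum>i\<in>{i\<in>I'. b i = t}. m i)"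
    by (rule sum.image_gen[OF fin'])
  finally show ?thesis by (simp add: key)
qed

text \<open>The combination is taken at every coordinate, including those outside the ground set,
  where points of a base polytope have the constant value \<open>undefined\<close>; there
  \<open>u + v = 1\<close> reproduces that value.\<close>

definition convex_fun_set :: "('a \<Rightarrow> real) set \<Rightarrow> bool" where
  "convex_fun_set K \<longleftrightarrow>
     (\<forall>x\<in>K. \<forall>y\<in>K. \<forall>u\<ge>0. \<forall>v\<ge>0. u + v = 1 \<longrightarrow> (\<lambda>i. u * x i + v * y i) \<in> K)"

lemma convex_fun_set_Int: "convex_fun_set K \<Longrightarrow> convex_fun_set L \<Longrightarrow> convex_fun_set (K \<inter> L)"
  by (simp add: convex_fun_set_def)

lemma convex_fun_set_coordinate: "convex_fun_set {y. y n = (t::real)}"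
  unfolding convex_fun_set_def by (auto simp flip: distrib_right)

text \<open>
  Nonemptiness is the Euler characteristic of a compact convex set. The coordinates from \<open>n\<close>
  onwards are frozen to those of \<open>z\<close>, so that the induction slices along coordinate \<open>n - 1\<close>
  without changing the ambient space.
\<close>

lemma euler_relation:
  fixes K :: "'i \<Rightarrow> (nat \<Rightarrow> real) set" and m :: "'i \<Rightarrow> int"
  assumes "finite I"
    and "\<And>i. i \<in> I \<Longrightarrow> compact (K i)" and "\<And>i. i \<in> I \<Longrightarrow> convex_fun_set (K i)"
    and "\<And>i y j. i \<in> I \<Longrightarrow> y \<in> K i \<Longrightarrow> n \<le> j \<Longrightarrow> y j = z j"
    and "\<And>y. (\<Sum>i\<in>I. m i * of_bool (y \<in> K i)) = 0"
  shows "(\<Sum>i\<in>I. m i * of_bool (K i \<noteq> {})) = 0"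
  using assms(2-)
proof (induction n arbitrary: K z)
  case 0
  have "of_bool (K i \<noteq> {}) = (of_bool (z \<in> K i) :: int)" if "i \<in> I" for i
  proof -
    have "y = z" if "y \<in> K i" for y using 0(3)[OF \<open>i \<in> I\<close> that] by auto
    then show ?thesis by (auto simp: of_bool_def)
  qed
  then show ?case using 0(4)[of z] by simp
next
  case (Suc n)
  \<comment> \<open>The projection to coordinate \<open>n\<close> is a compact interval that
    contains \<open>t\<close> exactly when the slice at \<open>t\<close> is nonempty. Hence the
    slice relations, which come from the induction hypothesis, are the input of the one-dimensional
    case.\<close>
  define J where "J i = (\<lambda>y. y n) ` K i" for i
  have slice: "(\<Sum>i\<in>I. m i * of_bool (K i \<inter> {y. y n = t} \<noteq> {})) = 0" for t
  proof (rule Suc.IH[of _ "z(n := t)"])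
    show "compact (K i \<inter> {y. y n = t})" if "i \<in> I" for i
      using Suc.prems(1)[OF that]
      by (intro compact_Int_closed closed_Collect_eq continuous_on_product_coordinates) auto
    show "convex_fun_set (K i \<inter> {y. y n = t})" if "i \<in> I" for i
      using Suc.prems(2)[OF that] by (intro convex_fun_set_Int convex_fun_set_coordinate)
    show "y j = (z(n := t)) j" if "i \<in> I" "y \<in> K i \<inter> {y. y n = t}" "n \<le> j" for i y j
      using that Suc.prems(3)[OF that(1), of y j] by auto
    show "(\<Sum>i\<in>I. m i * of_bool (y \<in> K i \<inter> {y. y n = t})) = 0" for y
      using Suc.prems(4)[of y] by (cases "y n = t") auto
  qed
  have "(\<Sum>i\<in>I. m i * of_bool (J i \<noteq> {})) = 0"
  proof (rule compact_interval_relation[OF assms(1)])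
    show "compact (J i)" if "i \<in> I" for i
      unfolding J_def using Suc.prems(1)[OF that]
      by (intro compact_continuous_image continuous_on_subset[OF continuous_on_product_coordinates]) auto
    show "is_interval (J i)" if "i \<in> I" for i
    proof -
      have "u *\<^sub>R s + v *\<^sub>R t \<in> J i"
        if st: "s \<in> J i" "t \<in> J i" "0 \<le> u" "0 \<le> v" "u + v = 1" for s t u v :: real
      proof -
        obtain x y where "x \<in> K i" "y \<in> K i" "s = x n" "t = y n"
          using st(1,2) by (auto simp: J_def)
        then show ?thesis
          using Suc.prems(2)[OF \<open>i \<in> I\<close>] st(3-)
          unfolding J_def convex_fun_set_def by (intro image_eqI[of _ _ "\<lambda>i. u * x i + v * y i"]) auto
      qed
      then show ?thesis
        unfolding is_interval_convex_1 by (simp add: convex_def)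
    qed
    have "t \<in> J i \<longleftrightarrow> K i \<inter> {y. y n = t} \<noteq> {}" for t i by (auto simp: J_def)
    then show "(\<Sum>i\<in>I. m i * of_bool (t \<in> J i)) = 0" for t
      using slice[of t] by simp
  qed
  then show ?case by (simp add: J_def)
qed

section \<open>Base polytopes: greedy vertices, compactness, convexity\<close>

lemma polymatroid_mono: "polymatroid d rk \<Longrightarrow> A \<subseteq> B \<Longrightarrow> B \<subseteq> {1..d} \<Longrightarrow> rk A \<le> rk B"
  by (simp add: polymatroid_def)

lemma polymatroid_submodular:
  "polymatroid d rk \<Longrightarrow> A \<subseteq> {1..d} \<Longrightarrow> B \<subseteq> {1..d} \<Longrightarrow> rk (A \<union> B) + rk (A \<inter> B) \<le> rk A + rk B"
  by (simp add: polymatroid_def)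

lemma polymatroid_empty: "polymatroid d rk \<Longrightarrow> rk {} = 0"
  by (simp add: polymatroid_def)

text \<open>Edmonds' greedy algorithm: the coordinate at \<open>\<tau> j\<close> is the rank gained
  from prefix \<open>j - 1\<close> to prefix \<open>j\<close>. The remaining inequalities survive
  each new element by submodularity.\<close>

lemma greedy_vertex:
  assumes pm: "polymatroid d rk" and \<tau>: "\<tau> permutes {1..d}"
  obtains v where "v \<in> base_polytope d rk"
    and "\<And>j. j \<le> d \<Longrightarrow> (\<Sum>i\<in>\<tau> ` {1..j}. v i) = real (rk (\<tau> ` {1..j}))"
proof -
  have inj: "inj \<tau>" using permutes_inj[OF \<tau>] .
  have sub: "\<tau> ` {1..j} \<subseteq> {1..d}" if "j \<le> d" for j
    using image_mono[of "{1..j}" "{1..d}" \<tau>] permutes_image[OF \<tau>] that by simp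
  have "\<exists>v::nat \<Rightarrow> real. (\<forall>A\<subseteq>\<tau> ` {1..j}. sum v A \<le> rk A) \<and> (\<forall>i\<le>j. sum v (\<tau> ` {1..i}) = rk (\<tau> ` {1..i}))"
    if "j \<le> d" for j
    using that
  proof (induction j)
    case 0
    then show ?case using polymatroid_empty[OF pm] by auto
  next
    case (Suc j)
    let ?X = "\<tau> ` {1..j}" and ?X' = "\<tau> ` {1..Suc j}" and ?x = "\<tau> (Suc j)"
    obtain v :: "nat \<Rightarrow> real" where v: "\<And>A. A \<subseteq> ?X \<Longrightarrow> sum v A \<le> rk A"
      "\<And>i. i \<le> j \<Longrightarrow> sum v (\<tau> ` {1..i}) = rk (\<tau> ` {1..i})"
      using Suc by auto
    have X': "?X' = insert ?x ?X" by (simp add: atLeastAtMostSuc_conv)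
    have x: "?x \<notin> ?X" using inj by (auto simp: inj_eq)
    define w where "w = v(?x := real (rk ?X') - real (rk ?X))"
    have w_old: "sum w A = sum v A" if "?x \<notin> A" for A
      using that by (intro sum.cong) (auto simp: w_def)
    have "sum w A \<le> rk A" if A: "A \<subseteq> ?X'" for A
    proof (cases "?x \<in> A")
      case True
      have "finite A" using A finite_subset by blast
      then have "sum w A = real (rk ?X') - real (rk ?X) + sum v (A - {?x})"
        using True by (simp add: sum.remove[of A ?x] w_old) (simp add: w_def)
      also have "sum v (A - {?x}) \<le> rk (A - {?x})" using A unfolding X' by (intro v(1)) blast
      finally have "sum w A \<le> real (rk ?X') - real (rk ?X) + real (rk (A - {?x}))" by simp
      \<comment> \<open>Submodularity for \<open>A\<close> and the previous prefix bounds the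
        marginal rank of the new element over the prefix by its marginal rank over the rest of
        \<open>A\<close>.\<close>
      moreover have "A \<union> ?X = ?X'" "A \<inter> ?X = A - {?x}" using A True x unfolding X' by blast+
      then have "rk ?X' + rk (A - {?x}) \<le> rk A + rk ?X"
        using polymatroid_submodular[OF pm, of A ?X] order_trans[OF A sub[OF Suc.prems]] sub[of j] Suc.prems
        by simp
      ultimately show ?thesis by linarith
    next
      case False
      then have "A \<subseteq> ?X" using A unfolding X' by blast
      then show ?thesis using False w_old v(1)[of A] by simp
    qed
    moreover have "sum w (\<tau> ` {1..i}) = rk (\<tau> ` {1..i})" if "i \<le> Suc j" for i
    proof (cases "i = Suc j")
      case True
      have "sum w ?X' = sum w ?X + w ?x" using x X' by simp
      then show ?thesis using True v(2)[of j] x by (simp add: w_old) (simp add: w_def)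
    next
      case False
      then have "?x \<notin> \<tau> ` {1..i}" using that inj by (auto simp: inj_eq)
      then show ?thesis using w_old v(2)[of i] False that by simp
    qed
    ultimately show ?case by blast
  qed
  from this[of d] obtain v :: "nat \<Rightarrow> real" where v: "\<And>A. A \<subseteq> {1..d} \<Longrightarrow> sum v A \<le> rk A"
    "\<And>i. i \<le> d \<Longrightarrow> sum v (\<tau> ` {1..i}) = rk (\<tau> ` {1..i})"
    using permutes_image[OF \<tau>] by auto
  \<comment> \<open>Points of the ambient space are extensional, so the vector is reset to
    \<open>undefined\<close> off the ground set without changing the relevant sums.\<close>
  have res: "sum (restrict v {1..d}) A = sum v A" if "A \<subseteq> {1..d}" for A
    using that by (intro sum.cong) auto
  have tot: "sum v {1..d} = rk {1..d}" using v(2)[of d] permutes_image[OF \<tau>] by simp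
  show thesis
  proof
    show "restrict v {1..d} \<in> base_polytope d rk"
      unfolding base_polytope_def using v(1) res tot by (simp del: restrict_apply)
    show "sum (restrict v {1..d}) (\<tau> ` {1..j}) = real (rk (\<tau> ` {1..j}))" if "j \<le> d" for j
      using res[OF sub[OF that]] v(2)[OF that] by simp
  qed
qed

lemma continuous_on_sum_coordinates: "continuous_on S (\<lambda>y::nat \<Rightarrow> real. \<Sum>i\<in>A. y i)"
  by (intro continuous_on_sum continuous_on_subset[OF continuous_on_product_coordinates]) auto

text \<open>Nonnegativity comes from monotonicity: the sum over the complement of \<open>i\<close>
  is at most the rank of that complement, hence at most the total.\<close>

lemma base_polytope_bounds:
  assumes pm: "polymatroid d rk" and y: "y \<in> base_polytope d rk" and i: "i \<in> {1..d}"
  shows "0 \<le> y i" and "y i \<le> real (rk {1..d})"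
proof -
  have le: "sum y A \<le> real (rk {1..d})" if "A \<subseteq> {1..d}" for A
    using y polymatroid_mono[OF pm that] that unfolding base_polytope_def
    by (auto intro: order_trans)
  have "sum y {1..d} = y i + sum y ({1..d} - {i})" using i by (intro sum.remove) auto
  then show "0 \<le> y i" using le[of "{1..d} - {i}"] y unfolding base_polytope_def by auto
  show "y i \<le> real (rk {1..d})" using le[of "{i}"] i by auto
qed

lemma compact_base_polytope:
  assumes pm: "polymatroid d rk"
  shows "compact (base_polytope d rk)"
proof -
  \<comment> \<open>Confining the coordinates outside the ground set to a single point makes the box
    a product of compact sets over all indices, so that Tychonoff's theorem applies.\<close>
  define B where "B i = (if i \<in> {1..d} then {0..real (rk {1..d})} else {undefined})" for i
  have "compact (PiE UNIV B)"
    using compactin_PiE[of "\<lambda>_. euclidean" UNIV B]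
    by (simp add: euclidean_product_topology flip: compactin_euclidean_iff) (simp add: B_def)
  moreover have "closed ({y::nat \<Rightarrow> real. (\<Sum>i\<in>{1..d}. y i) = real (rk {1..d})}
      \<inter> (\<Inter>A\<in>Pow {1..d}. {y. (\<Sum>i\<in>A. y i) \<le> real (rk A)}))"
    by (intro closed_Int closed_INT ballI closed_Collect_eq closed_Collect_le
        continuous_on_sum_coordinates continuous_on_const)
  moreover have "base_polytope d rk = PiE UNIV B \<inter>
    ({y. (\<Sum>i\<in>{1..d}. y i) = real (rk {1..d})} \<inter> (\<Inter>A\<in>Pow {1..d}. {y. (\<Sum>i\<in>A. y i) \<le> real (rk A)}))"
  proof (intro set_eqI iffI)
    fix y assume y: "y \<in> base_polytope d rk"
    then show "y \<in> PiE UNIV B \<inter>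
      ({y. (\<Sum>i\<in>{1..d}. y i) = real (rk {1..d})} \<inter> (\<Inter>A\<in>Pow {1..d}. {y. (\<Sum>i\<in>A. y i) \<le> real (rk A)}))"
      using base_polytope_bounds[OF pm y] by (auto simp: base_polytope_def B_def PiE_def extensional_def)
  next
    fix y assume y: "y \<in> PiE UNIV B \<inter>
      ({y. (\<Sum>i\<in>{1..d}. y i) = real (rk {1..d})} \<inter> (\<Inter>A\<in>Pow {1..d}. {y. (\<Sum>i\<in>A. y i) \<le> real (rk A)}))"
    then have "y i \<in> B i" for i by (auto simp: PiE_def)
    then have "y i = undefined" if "i \<notin> {1..d}" for i using that unfolding B_def by (metis singletonD)
    then show "y \<in> base_polytope d rk" using y by (auto simp: base_polytope_def PiE_def extensional_def)
  qed
  ultimately show ?thesis by (simp only: compact_Int_closed)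
qed

lemma convex_comb_le:
  fixes a b t u v :: real
  assumes "a \<le> t" "b \<le> t" "0 \<le> u" "0 \<le> v" "u + v = 1"
  shows "u * a + v * b \<le> t"
proof -
  have "u * a + v * b \<le> u * t + v * t" using assms by (intro add_mono mult_left_mono)
  also have "\<dots> = t" using assms(5) by (simp flip: distrib_right)
  finally show ?thesis .
qed

lemma sum_convex_comb:
  fixes x y :: "'a \<Rightarrow> real"
  shows "(\<Sum>i\<in>A. u * x i + v * y i) = u * sum x A + v * sum y A"
  by (simp add: sum.distrib sum_distrib_left)

lemma convex_fun_set_base_polytope: "convex_fun_set (base_polytope d rk)"
  unfolding convex_fun_set_def
proof (intro ballI allI impI)
  fix x y :: "nat \<Rightarrow> real" and u v :: real
  assume x: "x \<in> base_polytope d rk" and y: "y \<in> base_polytope d rk" and uv: "0 \<le> u" "0 \<le> v" "u + v = 1"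
  have "u * t + v * t = t" for t :: real using uv by (simp flip: distrib_right)
  moreover have "u * sum x A + v * sum y A \<le> real (rk A)" if "A \<subseteq> {1..d}" for A
    using x y that by (intro convex_comb_le uv) (auto simp: base_polytope_def)
  ultimately show "(\<lambda>i. u * x i + v * y i) \<in> base_polytope d rk"
    using x y by (auto simp: base_polytope_def sum_convex_comb PiE_def extensional_def)
qed

section \<open>From relations between indicator functions to relations along chains\<close>

text \<open>The relation survives intersection with \<open>L\<close>, since every term vanishes off
  \<open>L\<close>; the Euler characteristic then replaces points by nonemptiness.\<close>

lemma base_polytope_meet_relation:
  fixes m :: "(nat set \<Rightarrow> nat) \<Rightarrow> int"
  assumes "finite S" and S: "S \<subseteq> polymatroids d r" and "closed L" and "convex_fun_set L"
    and rel: "\<And>y. (\<Sum>rk\<in>S. m rk * indicator (base_polytope d rk) y) = 0"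
  shows "(\<Sum>rk\<in>S. m rk * of_bool (base_polytope d rk \<inter> L \<noteq> {})) = 0"
\<comment> \<open>Coordinates beyond \<open>d\<close> are frozen at \<open>undefined\<close>;
  coordinate 0, although outside the ground set, is sliced along with the others.\<close>
proof (rule euler_relation[OF \<open>finite S\<close>, where n = "Suc d" and z = "\<lambda>_. undefined"])
  show "compact (base_polytope d rk \<inter> L)" if "rk \<in> S" for rk
    using that S \<open>closed L\<close> by (intro compact_Int_closed compact_base_polytope) (auto simp: polymatroids_def)
  show "convex_fun_set (base_polytope d rk \<inter> L)" for rk
    by (intro convex_fun_set_Int convex_fun_set_base_polytope \<open>convex_fun_set L\<close>)
  show "y j = undefined" if "y \<in> base_polytope d rk \<inter> L" "Suc d \<le> j" for rk y j
    using that by (auto simp: base_polytope_def PiE_def extensional_def)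
  show "(\<Sum>rk\<in>S. m rk * of_bool (y \<in> base_polytope d rk \<inter> L)) = 0" for y
    using rel[of y] by (cases "y \<in> L") (auto simp: indicator_def)
qed

text \<open>The double sum covers both kinds of half-space used below: a singleton family bounds one
  partial sum, and the whole chain bounds the total of all partial sums.\<close>

lemma convex_fun_set_halfspace: "convex_fun_set {y. (t::real) \<le> (\<Sum>A\<in>\<A>. \<Sum>i\<in>A. y i)}"
  unfolding convex_fun_set_def
proof (intro ballI allI impI CollectI)
  fix x y :: "'a \<Rightarrow> real" and u v :: real
  assume x: "x \<in> {y. t \<le> (\<Sum>A\<in>\<A>. \<Sum>i\<in>A. y i)}" and y: "y \<in> {y. t \<le> (\<Sum>A\<in>\<A>. \<Sum>i\<in>A. y i)}"
    and uv: "0 \<le> u" "0 \<le> v" "u + v = 1"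
  have "u * (- (\<Sum>A\<in>\<A>. sum x A)) + v * (- (\<Sum>A\<in>\<A>. sum y A)) \<le> - t"
    using x y by (intro convex_comb_le uv) auto
  then show "t \<le> (\<Sum>A\<in>\<A>. \<Sum>i\<in>A. u * x i + v * y i)"
    by (simp add: sum_convex_comb sum.distrib flip: sum_distrib_left)
qed

lemma convex_fun_set_INT:
  assumes "\<And>j. j \<in> J \<Longrightarrow> convex_fun_set (K j)"
  shows "convex_fun_set (\<Inter>j\<in>J. K j)"
  using assms by (simp add: convex_fun_set_def)

text \<open>
  Given that all ranks along the chain are at least \<open>a\<close>, they are equal to \<open>a\<close> iff their sum does
  not reach \<open>\<Sum>a + 1\<close>. A greedy vertex maximises all partial sums along the chain at once, so both
  conditions say whether the base polytope meets a convex set.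
\<close>

lemma chain_ranks_relation:
  fixes m :: "(nat set \<Rightarrow> nat) \<Rightarrow> int"
  assumes fin: "finite S" and S: "S \<subseteq> polymatroids d r" and \<tau>: "\<tau> permutes {1..d}"
    and rel: "\<And>y. (\<Sum>rk\<in>S. m rk * indicator (base_polytope d rk) y) = 0"
  shows "(\<Sum>rk\<in>S. m rk * of_bool (\<forall>j\<le>d. rk (\<tau> ` {1..j}) = a j)) = 0"
proof -
  define L where "L = (\<Inter>j\<in>{..d}. {y::nat \<Rightarrow> real. real (a j) \<le> (\<Sum>A\<in>{\<tau> ` {1..j}}. \<Sum>i\<in>A. y i)})"
  define \<A> where "\<A> = (\<lambda>j. \<tau> ` {1..j}) ` {..d}"
  \<comment> \<open>Ranks are integers, so exceeding the total of \<open>a\<close> means exceeding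
    it by at least 1. This keeps the half-space closed, as compactness of the intersections
    requires.\<close>
  define H where "H = {y::nat \<Rightarrow> real. real (\<Sum>j\<le>d. a j) + 1 \<le> (\<Sum>A\<in>\<A>. \<Sum>i\<in>A. y i)}"
  \<comment> \<open>Prefixes of different lengths are different sets, so a sum over the set
    \<open>\<A>\<close> counts every prefix once.\<close>
  have inj: "inj_on (\<lambda>j. \<tau> ` {1..j}) {..d}"
  proof (rule inj_onI)
    fix i j assume "\<tau> ` {1..i} = \<tau> ` {1..j}"
    then have "card (\<tau> ` {1..i}) = card (\<tau> ` {1..j})" by simp
    then show "i = j" using permutes_inj_on[OF \<tau>] by (simp add: card_image)
  qed
  have sum_\<A>: "(\<Sum>A\<in>\<A>. g A) = (\<Sum>j\<le>d. g (\<tau> ` {1..j}))" for g :: "nat set \<Rightarrow> real"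
    using sum.reindex[OF inj, of g] by (simp only: \<A>_def o_def)
  have closed: "closed {y::nat \<Rightarrow> real. t \<le> (\<Sum>A\<in>\<B>. \<Sum>i\<in>A. y i)}" for t \<B>
    by (intro closed_Collect_le continuous_on_sum continuous_on_sum_coordinates continuous_on_const)
  have "closed L" unfolding L_def by (intro closed_INT ballI closed)
  have "convex_fun_set L"
    unfolding L_def by (intro convex_fun_set_INT convex_fun_set_halfspace)
  have "closed (L \<inter> H)" "convex_fun_set (L \<inter> H)"
    unfolding H_def by (intro closed_Int convex_fun_set_Int convex_fun_set_halfspace closed \<open>closed L\<close> \<open>convex_fun_set L\<close>)+
  have split: "m rk * of_bool (\<forall>j\<le>d. rk (\<tau> ` {1..j}) = a j) =
      m rk * of_bool (base_polytope d rk \<inter> L \<noteq> {}) - m rk * of_bool (base_polytope d rk \<inter> (L \<inter> H) \<noteq> {})"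
    if "rk \<in> S" for rk
  proof -
    have pm: "polymatroid d rk" using that S by (auto simp: polymatroids_def)
    obtain v where v: "v \<in> base_polytope d rk"
      "\<And>j. j \<le> d \<Longrightarrow> (\<Sum>i\<in>\<tau> ` {1..j}. v i) = real (rk (\<tau> ` {1..j}))"
      using greedy_vertex[OF pm \<tau>] by blast
    have ub: "sum y (\<tau> ` {1..j}) \<le> real (rk (\<tau> ` {1..j}))" if "y \<in> base_polytope d rk" "j \<le> d" for y j
    proof -
      have "\<tau> ` {1..j} \<subseteq> {1..d}"
        using image_mono[of "{1..j}" "{1..d}" \<tau>] permutes_image[OF \<tau>] that(2) by simp
      then show ?thesis using that(1) by (simp add: base_polytope_def)
    qed
    have ub_sum: "(\<Sum>j\<le>d. sum y (\<tau> ` {1..j})) \<le> real (\<Sum>j\<le>d. rk (\<tau> ` {1..j}))"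
      if "y \<in> base_polytope d rk" for y
      unfolding of_nat_sum by (intro sum_mono ub that) auto
    have L: "base_polytope d rk \<inter> L \<noteq> {} \<longleftrightarrow> (\<forall>j\<le>d. a j \<le> rk (\<tau> ` {1..j}))"
    proof
      assume "base_polytope d rk \<inter> L \<noteq> {}"
      then obtain y where y: "y \<in> base_polytope d rk" "y \<in> L" by blast
      have "real (a j) \<le> real (rk (\<tau> ` {1..j}))" if "j \<le> d" for j
      proof -
        have "real (a j) \<le> sum y (\<tau> ` {1..j})" using y(2) that by (simp add: L_def)
        then show ?thesis using ub[OF y(1) that] by linarith
      qed
      then show "\<forall>j\<le>d. a j \<le> rk (\<tau> ` {1..j})" by simp
    next
      assume "\<forall>j\<le>d. a j \<le> rk (\<tau> ` {1..j})"
      then have "v \<in> L" using v(2) by (simp add: L_def)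
      then show "base_polytope d rk \<inter> L \<noteq> {}" using v(1) by blast
    qed
    have LH: "base_polytope d rk \<inter> (L \<inter> H) \<noteq> {} \<longleftrightarrow>
        base_polytope d rk \<inter> L \<noteq> {} \<and> (\<Sum>j\<le>d. a j) < (\<Sum>j\<le>d. rk (\<tau> ` {1..j}))"
    proof
      assume "base_polytope d rk \<inter> (L \<inter> H) \<noteq> {}"
      then obtain y where y: "y \<in> base_polytope d rk" "y \<in> L" "y \<in> H" by blast
      have "real (\<Sum>j\<le>d. a j) + 1 \<le> (\<Sum>j\<le>d. sum y (\<tau> ` {1..j}))"
        using y(3) sum_\<A>[of "sum y"] by (simp add: H_def)
      then have "real (\<Sum>j\<le>d. a j) < real (\<Sum>j\<le>d. rk (\<tau> ` {1..j}))"
        using ub_sum[OF y(1)] by linarith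
      then show "base_polytope d rk \<inter> L \<noteq> {} \<and> (\<Sum>j\<le>d. a j) < (\<Sum>j\<le>d. rk (\<tau> ` {1..j}))"
        using y by (simp only: of_nat_less_iff) blast
    next
      assume *: "base_polytope d rk \<inter> L \<noteq> {} \<and> (\<Sum>j\<le>d. a j) < (\<Sum>j\<le>d. rk (\<tau> ` {1..j}))"
      then have "v \<in> L" using v(2) L by (simp add: L_def)
      moreover have "real (\<Sum>j\<le>d. a j) + 1 \<le> real (\<Sum>j\<le>d. rk (\<tau> ` {1..j}))"
        using * by linarith
      then have "v \<in> H" using v(2) sum_\<A>[of "sum v"] by (simp add: H_def)
      ultimately show "base_polytope d rk \<inter> (L \<inter> H) \<noteq> {}" using v(1) by blast
    qed
    show ?thesis
    proof (cases "\<forall>j\<le>d. a j \<le> rk (\<tau> ` {1..j})")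
      case True
      have "(\<forall>j\<le>d. rk (\<tau> ` {1..j}) = a j) \<longleftrightarrow> \<not> (\<Sum>j\<le>d. a j) < (\<Sum>j\<le>d. rk (\<tau> ` {1..j}))"
      proof
        assume "\<not> (\<Sum>j\<le>d. a j) < (\<Sum>j\<le>d. rk (\<tau> ` {1..j}))"
        then show "\<forall>j\<le>d. rk (\<tau> ` {1..j}) = a j"
        proof (rule contrapos_np)
          assume "\<not> (\<forall>j\<le>d. rk (\<tau> ` {1..j}) = a j)"
          then obtain j where "j \<le> d" "a j < rk (\<tau> ` {1..j})" using True by (metis le_neq_implies_less)
          then show "(\<Sum>j\<le>d. a j) < (\<Sum>j\<le>d. rk (\<tau> ` {1..j}))"
            using True by (intro sum_strict_mono_ex1) auto
        qed
      qed simp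
      then show ?thesis using True L LH by simp
    next
      case False
      then have "\<not> (\<forall>j\<le>d. rk (\<tau> ` {1..j}) = a j)" by auto
      then show ?thesis using False L LH by simp
    qed
  qed
  have "(\<Sum>rk\<in>S. m rk * of_bool (\<forall>j\<le>d. rk (\<tau> ` {1..j}) = a j)) =
      (\<Sum>rk\<in>S. m rk * of_bool (base_polytope d rk \<inter> L \<noteq> {}))
      - (\<Sum>rk\<in>S. m rk * of_bool (base_polytope d rk \<inter> (L \<inter> H) \<noteq> {}))"
    unfolding sum_subtractf[symmetric] by (rule sum.cong[OF refl split])
  also have "\<dots> = 0 - 0"
    by (intro arg_cong2[of _ _ _ _ "(-)"] base_polytope_meet_relation[OF fin S _ _ rel]
        \<open>closed L\<close> \<open>convex_fun_set L\<close> \<open>closed (L \<inter> H)\<close> \<open>convex_fun_set (L \<inter> H)\<close>)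
  finally show ?thesis by simp
qed

lemma finite_polymatroids: "finite (polymatroids d r)"
proof (rule finite_subset)
  show "polymatroids d r \<subseteq> Pow {1..d} \<rightarrow>\<^sub>E {..r}"
  proof
    fix rk assume "rk \<in> polymatroids d r"
    then show "rk \<in> Pow {1..d} \<rightarrow>\<^sub>E {..r}"
      using polymatroid_mono[of d rk _ "{1..d}"] by (auto simp: polymatroids_def polymatroid_def PiE_def)
  qed
qed (intro finite_PiE, auto)

section \<open>Inclusion-exclusion over chains of violated inequalities\<close>

text \<open>The faces of the order complex of \<open>N\<close> under inclusion. The empty chain is a
  member, so the sum of \<open>(-1) ^ card C\<close> is the reduced Euler characteristic up to
  sign.\<close>

definition subset_chains :: "'a set set \<Rightarrow> 'a set set set" where
  "subset_chains N = {C. C \<subseteq> N \<and> (\<forall>A\<in>C. \<forall>B\<in>C. A \<subseteq> B \<or> B \<subseteq> A)}"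

text \<open>The comparisons of \<open>A\<close> with \<open>A \<union> A0\<close> and of that with
  \<open>A0\<close> contract the order complex to the point \<open>A0\<close>. The proof replaces
  the contraction by a pairing of chains.\<close>

lemma subset_chains_alternating_sum:
  assumes fin: "finite N"
    and cone: "N \<noteq> {} \<Longrightarrow> \<exists>A0\<in>N. \<forall>A\<in>N. A \<union> A0 \<in> N"
  shows "(\<Sum>C\<in>subset_chains N. (-1::int) ^ card C) = of_bool (N = {})"
proof (cases "N = {}")
  case True
  then have "subset_chains N = {{}}" by (auto simp: subset_chains_def)
  then show ?thesis using True by simp
next
  case False
  then obtain A0 where A0: "A0 \<in> N" "\<And>A. A \<in> N \<Longrightarrow> A \<union> A0 \<in> N" using cone by blast
  \<comment> \<open>Toggling \<open>U C\<close> is a sign-reversing involution on the chains.\<close>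
  define U where "U C = A0 \<union> \<Union>{c\<in>C. \<not> A0 \<subseteq> c}" for C
  define \<phi> where "\<phi> C = (if U C \<in> C then C - {U C} else insert (U C) C)" for C
  \<comment> \<open>\<open>U C\<close> depends only on the members of \<open>C\<close> that do not
    contain \<open>A0\<close>, and the toggled set contains \<open>A0\<close>.\<close>
  have U\<phi>: "U (\<phi> C) = U C" for C
  proof -
    have "A0 \<subseteq> U C" by (auto simp: U_def)
    then have "{c\<in>\<phi> C. \<not> A0 \<subseteq> c} = {c\<in>C. \<not> A0 \<subseteq> c}" by (auto simp: \<phi>_def)
    then show ?thesis by (simp add: U_def)
  qed
  have fin_chain: "finite C" if "C \<in> subset_chains N" for C
    using that fin finite_subset by (auto simp: subset_chains_def)
  \<comment> \<open>In a finite chain the members not containing \<open>A0\<close> have a largest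
    one, if there are any, so \<open>U C\<close> is either \<open>A0\<close> or the join of that
    member with \<open>A0\<close>. Members that do contain \<open>A0\<close> lie above all of these,
    hence above \<open>U C\<close>.\<close>
  have U: "U C \<in> N \<and> (\<forall>c\<in>C. c \<subseteq> U C \<or> U C \<subseteq> c)" if C: "C \<in> subset_chains N" for C
  proof -
    have chain: "c \<subseteq> c' \<or> c' \<subseteq> c" if "c \<in> C" "c' \<in> C" for c c'
      using C that by (auto simp: subset_chains_def)
    let ?D = "{c\<in>C. \<not> A0 \<subseteq> c}"
    have "\<Union>?D \<in> ?D" if "?D \<noteq> {}"
      using chain fin_chain[OF C] that
      by (intro Union_in_chain[where \<A> = UNIV]) (auto simp: subset_chain_def)
    then have "?D = {} \<or> \<Union>?D \<in> ?D" by blast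
    then have "U C \<in> N"
    proof
      assume "\<Union>?D \<in> ?D"
      then have "\<Union>?D \<in> N" using C by (auto simp: subset_chains_def)
      then show ?thesis using A0(2) unfolding U_def by (metis Un_commute)
    next
      assume "?D = {}"
      then show ?thesis using A0(1) unfolding U_def by (simp only: Union_empty Un_empty_right)
    qed
    moreover have "c \<subseteq> U C \<or> U C \<subseteq> c" if c: "c \<in> C" for c
    proof (cases "A0 \<subseteq> c")
      case True
      have "c' \<subseteq> c" if "c' \<in> ?D" for c' using that chain[OF c, of c'] True by auto
      then show ?thesis using True by (auto simp: U_def)
    next
      case False
      then show ?thesis using c by (auto simp: U_def)
    qed
    ultimately show ?thesis by blast
  qed
  have \<phi>_in: "\<phi> C \<in> subset_chains N" if "C \<in> subset_chains N" for C
    using that U[OF that] by (auto simp: subset_chains_def \<phi>_def)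
  have \<phi>\<phi>: "\<phi> (\<phi> C) = C" for C
    unfolding \<phi>_def[of "\<phi> C"] U\<phi> by (auto simp: \<phi>_def)
  have sgn: "(-1::int) ^ card (\<phi> C) = - ((-1) ^ card C)" if "C \<in> subset_chains N" for C
  proof (cases "U C \<in> C")
    case True
    then have "card C = Suc (card (\<phi> C))"
      using card.remove[OF fin_chain[OF that]] by (simp add: \<phi>_def)
    then show ?thesis by simp
  next
    case False
    then show ?thesis using fin_chain[OF that] by (simp add: \<phi>_def)
  qed
  have "(\<Sum>C\<in>subset_chains N. (-1::int) ^ card C) = (\<Sum>C\<in>subset_chains N. (-1) ^ card (\<phi> C))"
    by (rule sum.reindex_bij_witness[of _ \<phi> \<phi>]) (auto simp: \<phi>\<phi> \<phi>_in)
  also have "\<dots> = - (\<Sum>C\<in>subset_chains N. (-1) ^ card C)"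
    by (simp add: sgn sum_negf)
  finally show ?thesis using False by simp
qed

text \<open>
  For submodular \<open>rk\<close>, a minimiser of \<open>rk - sum y\<close> is a cone point of the poset of violated
  inequalities, so the reduced Euler characteristic of this poset vanishes unless it is empty.
\<close>

lemma indicator_base_polytope:
  assumes pm: "polymatroid d rk" and y: "y \<in> {1..d} \<rightarrow>\<^sub>E UNIV" "(\<Sum>i\<in>{1..d}. y i) = real (rk {1..d})"
  shows "(indicator (base_polytope d rk) y :: int) =
    (\<Sum>C\<in>subset_chains (Pow {1..d}). (-1) ^ card C * of_bool (\<forall>A\<in>C. real (rk A) < sum y A))"
proof -
  define N where "N = {A. A \<subseteq> {1..d} \<and> real (rk A) < sum y A}"
  have fin: "finite N" by (simp add: N_def)
  have "\<exists>A0\<in>N. \<forall>A\<in>N. A \<union> A0 \<in> N" if N: "N \<noteq> {}"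
  proof -
    define D where "D A = real (rk A) - sum y A" for A
    obtain A0 where A0: "A0 \<in> N" "\<And>A. A \<in> N \<Longrightarrow> D A0 \<le> D A"
      using arg_min_if_finite(1)[OF fin N, of D] arg_min_least[OF fin N, of _ D] by blast
    \<comment> \<open>Outside \<open>N\<close> the value of \<open>D\<close> is nonnegative, while
      it is negative at \<open>A0\<close>; the minimum over \<open>N\<close> is thus global. This
      matters because \<open>A \<inter> A0\<close> may leave \<open>N\<close>.\<close>
    have min: "D A0 \<le> D A" if "A \<subseteq> {1..d}" for A
    proof (cases "A \<in> N")
      case False
      then show ?thesis using A0(1) that by (auto simp: N_def D_def)
    qed (rule A0(2))
    \<comment> \<open>\<open>D\<close> is a submodular function minus a modular one, hence
      submodular. Minimality at the intersection then leaves
      \<open>D (A \<union> A0) \<le> D A < 0\<close>.\<close>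
    have "A \<union> A0 \<in> N" if A: "A \<in> N" for A
    proof -
      have sub: "A \<subseteq> {1..d}" "A0 \<subseteq> {1..d}" using A A0 by (auto simp: N_def)
      then have "finite A" "finite A0" using finite_subset by blast+
      then have "sum y (A \<union> A0) + sum y (A \<inter> A0) = sum y A + sum y A0" by (rule sum.union_inter)
      moreover have "D A0 \<le> D (A \<inter> A0)" using sub by (intro min) auto
      moreover have "D A < 0" using A by (auto simp: N_def D_def)
      ultimately have "D (A \<union> A0) < 0"
        using polymatroid_submodular[OF pm sub] unfolding D_def by linarith
      then show ?thesis using sub by (auto simp: N_def D_def)
    qed
    then show ?thesis using A0(1) by blast
  qed
  then have "(\<Sum>C\<in>subset_chains N. (-1::int) ^ card C) = of_bool (N = {})"
    by (intro subset_chains_alternating_sum fin)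
  moreover have "indicator (base_polytope d rk) y = (of_bool (N = {}) :: int)"
    using y by (auto simp: indicator_def base_polytope_def N_def not_less)
  moreover have "(\<Sum>C\<in>subset_chains N. (-1::int) ^ card C) =
    (\<Sum>C\<in>subset_chains (Pow {1..d}). (-1) ^ card C * of_bool (\<forall>A\<in>C. real (rk A) < sum y A))"
  proof (rule sum.mono_neutral_cong_left)
    have "subset_chains (Pow {1..d}) \<subseteq> Pow (Pow {1..d})" by (auto simp: subset_chains_def)
    then show "finite (subset_chains (Pow {1..d}))" by (rule finite_subset) simp
  qed (auto simp: subset_chains_def N_def)
  ultimately show ?thesis by simp
qed

section \<open>Refining chains of subsets to complete flags\<close>

text \<open>The enumeration is built from its end: its last element is chosen outside the union of
  all members other than \<open>V\<close>, which is a proper subset because a nonempty finite chain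
  contains its union. Deleting that element leaves a smaller instance.\<close>

lemma subset_chain_refinement:
  assumes "finite V" and "C \<in> subset_chains (Pow V)"
  shows "\<exists>f. bij_betw f {1..card V} V \<and> (\<forall>A\<in>C. \<exists>j\<le>card V. A = f ` {1..j})"
  using assms
proof (induction "card V" arbitrary: V C)
  case 0
  then have "V = {}" "C \<subseteq> {{}}" by (auto simp: subset_chains_def)
  then show ?case by (auto simp: bij_betw_def intro!: exI[of _ id])
next
  case (Suc n)
  let ?D = "C - {V}"
  have chain: "c \<subseteq> c' \<or> c' \<subseteq> c" if "c \<in> C" "c' \<in> C" for c c'
    using Suc.prems that by (auto simp: subset_chains_def)
  have fin: "finite ?D" using Suc.prems by (auto simp: subset_chains_def intro: finite_subset[of _ "Pow V"])
  have "\<Union>?D \<in> ?D" if "?D \<noteq> {}"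
    using chain fin that by (intro Union_in_chain[where \<A> = UNIV]) (auto simp: subset_chain_def)
  moreover have "V \<noteq> {}" using Suc.hyps(2) by auto
  ultimately have "\<Union>?D \<noteq> V" by (cases "?D = {}") auto
  moreover have "\<Union>?D \<subseteq> V" using Suc.prems by (auto simp: subset_chains_def)
  ultimately obtain x where x: "x \<in> V" "x \<notin> \<Union>?D" by blast
  have n: "n = card (V - {x})" using Suc.hyps(2) x(1) Suc.prems(1) by simp
  have D: "?D \<in> subset_chains (Pow (V - {x}))" using Suc.prems(2) x by (auto simp: subset_chains_def)
  have "\<exists>f. bij_betw f {1..n} (V - {x}) \<and> (\<forall>A\<in>?D. \<exists>j\<le>n. A = f ` {1..j})"
    using Suc.hyps(1)[OF n finite_Diff[OF Suc.prems(1)] D] unfolding n[symmetric] .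
  then obtain f where f: "bij_betw f {1..n} (V - {x})" "\<forall>A\<in>?D. \<exists>j\<le>n. A = f ` {1..j}"
    by (elim exE conjE)
  define g where "g = f(Suc n := x)"
  have gf: "g ` {1..j} = f ` {1..j}" if "j \<le> n" for j
    using that by (intro image_cong) (auto simp: g_def)
  have "bij_betw g {1..n} (V - {x}) \<longleftrightarrow> bij_betw f {1..n} (V - {x})"
    by (rule bij_betw_cong) (simp add: g_def)
  moreover have "bij_betw g {Suc n} {x}" by (simp add: g_def bij_betw_def)
  ultimately have "bij_betw g ({1..n} \<union> {Suc n}) ((V - {x}) \<union> {x})"
    using f(1) by (intro bij_betw_combine) auto
  then have g: "bij_betw g {1..Suc n} V"
    using x(1) by (simp add: atLeastAtMostSuc_conv insert_absorb)
  moreover have "\<exists>j\<le>Suc n. A = g ` {1..j}" if A: "A \<in> C" for A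
  proof (cases "A = V")
    case True
    then show ?thesis using g by (auto simp: bij_betw_def)
  next
    case False
    then obtain j where "j \<le> n" "A = f ` {1..j}" using bspec[OF f(2), of A] A by auto
    then have "j \<le> Suc n \<and> A = g ` {1..j}" using gf[of j] by simp
    then show ?thesis by blast
  qed
  ultimately show ?case using Suc.hyps(2) by auto
qed

lemma subset_chain_permutation:
  fixes d :: nat
  assumes "C \<in> subset_chains (Pow {1..d})"
  obtains \<tau> where "\<tau> permutes {1..d}" and "\<And>A. A \<in> C \<Longrightarrow> \<exists>j\<le>d. A = \<tau> ` {1..j}"
proof -
  obtain f where f: "bij_betw f {1..d} {1..d}" "\<forall>A\<in>C. \<exists>j\<le>d. A = f ` {1..j}"
    using subset_chain_refinement[OF finite_atLeastAtMost assms]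
    unfolding card_atLeastAtMost diff_Suc_1 by (elim exE conjE)
  define \<tau> where "\<tau> j = (if j \<in> {1..d} then f j else j)" for j
  have "\<tau> permutes {1..d}"
    
  proof (rule bij_imp_permutes)
    have "bij_betw \<tau> {1..d} {1..d} \<longleftrightarrow> bij_betw f {1..d} {1..d}"
      by (rule bij_betw_cong) (simp add: \<tau>_def)
    then show "bij_betw \<tau> {1..d} {1..d}" using f(1) by simp
  qed (simp only: \<tau>_def if_False)
  moreover have "\<exists>j\<le>d. A = \<tau> ` {1..j}" if A: "A \<in> C" for A
  proof -
    obtain j where j: "j \<le> d" "A = f ` {1..j}" using bspec[OF f(2) A] by auto
    have "\<tau> ` {1..j} = f ` {1..j}"
      using j(1) by (intro image_cong refl) (simp add: \<tau>_def)
    then show ?thesis using j by blast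
  qed
  ultimately show thesis by (rule that)
qed

section \<open>Valuative functions as annihilators of integer relations\<close>

lemma fun_sum_apply: "(\<Sum>i\<in>I. f i) x = (\<Sum>i\<in>I. f i x)"
  by (induction I rule: infinite_finite_induct) auto

lemma sum_of_bool_singleton:
  fixes g :: "'a \<Rightarrow> 'b::semiring_1"
  assumes "finite S"
  shows "(\<Sum>x'\<in>S. of_bool (x' = x) * g x') = (if x \<in> S then g x else 0)"
    and "(\<Sum>x'\<in>S. g x' * of_bool (x = x')) = (if x \<in> S then g x else 0)"
proof -
  have "of_bool (x' = x) * g x' = (if x' = x then g x' else 0)" "g x' * of_bool (x = x') = (if x' = x then g x' else 0)" for x'
    by auto
  then show "(\<Sum>x'\<in>S. of_bool (x' = x) * g x') = (if x \<in> S then g x else 0)"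
    "(\<Sum>x'\<in>S. g x' * of_bool (x = x')) = (if x \<in> S then g x else 0)"
    by (simp_all only: sum.delta[OF assms])
qed

text \<open>Coefficients are indexed by \<open>S\<close> rather than by the image, in the same form
  as the relations between indicator functions.\<close>

lemma int_span_image_iff:
  fixes Q :: "'a \<Rightarrow> 'b \<Rightarrow> int"
  assumes "finite S"
  shows "g \<in> int_fun.span (Q ` S) \<longleftrightarrow> (\<exists>m. g = (\<lambda>y. \<Sum>x\<in>S. m x * Q x y))"
proof
  assume "g \<in> int_fun.span (Q ` S)"
  then show "\<exists>m. g = (\<lambda>y. \<Sum>x\<in>S. m x * Q x y)"
  proof (induction rule: int_fun.span_induct_alt)
    case base
    show ?case by (rule exI[of _ "\<lambda>_. 0"]) (auto simp: fun_eq_iff)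
  next
    case (step c g h)
    then obtain x m where x: "x \<in> S" "g = Q x" and h: "h = (\<lambda>y. \<Sum>x\<in>S. m x * Q x y)" by blast
    have "(\<Sum>x'\<in>S. (m x' + c * of_bool (x' = x)) * Q x' y) = c * Q x y + h y" for y
      using x(1) sum_of_bool_singleton(1)[OF assms, of x "\<lambda>x'. c * Q x' y"]
      by (simp only: h distrib_right sum.distrib mult.assoc mult.left_commute if_True add.commute)
    then show ?case using x(2) by (auto simp: fun_eq_iff intro!: exI[of _ "\<lambda>x'. m x' + c * of_bool (x' = x)"])
  qed
next
  assume "\<exists>m. g = (\<lambda>y. \<Sum>x\<in>S. m x * Q x y)"
  then obtain m where "g = (\<lambda>y. \<Sum>x\<in>S. m x * Q x y)" by blast
  then have "g = (\<Sum>x\<in>S. (\<lambda>y. m x * Q x y))" by (simp add: fun_eq_iff fun_sum_apply)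
  moreover have "(\<Sum>x\<in>S. (\<lambda>y. m x * Q x y)) \<in> int_fun.span (Q ` S)"
    by (intro int_fun.span_sum int_fun.span_scale int_fun.span_base imageI)
  ultimately show "g \<in> int_fun.span (Q ` S)" by simp
qed

text \<open>Additivity forces compatibility with integer multiples, by induction from 0 in both
  directions. As \<open>F\<close> is controlled only on the span, each intermediate sum must be
  located there.\<close>

lemma additive_on_sum_of_int:
  fixes F :: "('b \<Rightarrow> int) \<Rightarrow> rat"
  assumes add: "\<And>g h. g \<in> int_fun.span M \<Longrightarrow> h \<in> int_fun.span M \<Longrightarrow> F (g + h) = F g + F h"
    and "finite S" and Q: "\<And>x. x \<in> S \<Longrightarrow> Q x \<in> int_fun.span M"
  shows "F (\<lambda>y. \<Sum>x\<in>S. m x * Q x y) = (\<Sum>x\<in>S. of_int (m x) * F (Q x))"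
proof -
  have F0: "F 0 = 0" using add[OF int_fun.span_zero int_fun.span_zero] by simp
  have scale: "F (\<lambda>y. c * g y) = of_int c * F g" if g: "g \<in> int_fun.span M" for c g
  proof (induction c rule: int_induct[of _ 0])
    case base
    then show ?case using F0 by (simp add: zero_fun_def)
  next
    case (step1 i)
    have "(\<lambda>y. (i + 1) * g y) = (\<lambda>y. i * g y) + g" by (auto simp: fun_eq_iff algebra_simps)
    then show ?case using add[OF int_fun.span_scale[OF g, of i] g] step1 by (simp add: algebra_simps)
  next
    case (step2 i)
    have "(\<lambda>y. i * g y) = (\<lambda>y. (i - 1) * g y) + g" by (auto simp: fun_eq_iff algebra_simps)
    then show ?case using add[OF int_fun.span_scale[OF g, of "i - 1"] g] step2 by (simp add: algebra_simps)
  qed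
  have "F (\<Sum>x\<in>S. (\<lambda>y. m x * Q x y)) = (\<Sum>x\<in>S. of_int (m x) * F (Q x))"
    using \<open>finite S\<close> Q
  proof (induction S)
    case (insert x S)
    have Qx: "Q x \<in> int_fun.span M" using insert.prems by simp
    have "(\<Sum>x\<in>S. (\<lambda>y. m x * Q x y)) \<in> int_fun.span M"
      using insert.prems by (intro int_fun.span_sum int_fun.span_scale) auto
    then have "F ((\<lambda>y. m x * Q x y) + (\<Sum>x\<in>S. (\<lambda>y. m x * Q x y)))
        = of_int (m x) * F (Q x) + F (\<Sum>x\<in>S. (\<lambda>y. m x * Q x y))"
      by (simp only: add[OF int_fun.span_scale[OF Qx, of "m x"]] scale[OF Qx])
    then show ?case
      by (simp only: sum.insert[OF insert.hyps] insert.IH[OF insert.prems[OF insertI2]])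
  qed (simp add: F0)
  moreover have "(\<Sum>x\<in>S. (\<lambda>y. m x * Q x y)) = (\<lambda>y. \<Sum>x\<in>S. m x * Q x y)"
    by (simp add: fun_eq_iff fun_sum_apply)
  ultimately show ?thesis by simp
qed

text \<open>The module of indicator functions is the free integer module on \<open>S\<close> modulo
  its relations, so values on generators extend to a homomorphism exactly when they kill the
  relations.\<close>

lemma valuative_iff_relations:
  fixes f :: "(nat set \<Rightarrow> nat) \<Rightarrow> rat"
  assumes "finite S"
  shows "valuative d S f \<longleftrightarrow>
    (\<forall>m::_ \<Rightarrow> int. (\<forall>y. (\<Sum>rk\<in>S. m rk * indicator (base_polytope d rk) y) = 0)
       \<longrightarrow> (\<Sum>rk\<in>S. of_int (m rk) * f rk) = 0)"
    (is "_ \<longleftrightarrow> ?R")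
proof
  let ?Q = "\<lambda>rk. indicator (base_polytope d rk) :: _ \<Rightarrow> int"
  assume "valuative d S f"
  then obtain F where add: "\<And>g h. g \<in> int_fun.span (?Q ` S) \<Longrightarrow> h \<in> int_fun.span (?Q ` S) \<Longrightarrow> F (g + h) = F g + F h"
    and F: "\<And>rk. rk \<in> S \<Longrightarrow> f rk = F (?Q rk)"
    unfolding valuative_def indicator_module_def by blast
  show ?R
  proof (intro allI impI)
    fix m :: "_ \<Rightarrow> int" assume "\<forall>y. (\<Sum>rk\<in>S. m rk * ?Q rk y) = 0"
    then have "(\<lambda>y. \<Sum>rk\<in>S. m rk * ?Q rk y) = 0" by (simp add: fun_eq_iff)
    moreover have "F 0 = 0" using add[OF int_fun.span_zero int_fun.span_zero] by simp
    moreover have "F (\<lambda>y. \<Sum>rk\<in>S. m rk * ?Q rk y) = (\<Sum>rk\<in>S. of_int (m rk) * F (?Q rk))"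
      by (rule additive_on_sum_of_int[where M = "?Q ` S", OF add])
        (auto intro: assms int_fun.span_base)
    ultimately show "(\<Sum>rk\<in>S. of_int (m rk) * f rk) = 0" by (simp add: F)
  qed
next
  let ?Q = "\<lambda>rk. indicator (base_polytope d rk) :: _ \<Rightarrow> int"
  assume R: ?R
  define ev where "ev m = (\<lambda>y. \<Sum>rk\<in>S. m rk * ?Q rk y)" for m
  define val where "val m = (\<Sum>rk\<in>S. of_int (m rk) * f rk)" for m :: "_ \<Rightarrow> int"
  have val_cong: "val m = val n" if "ev m = ev n" for m n
  proof -
    have "ev (\<lambda>rk. m rk - n rk) y = 0" for y
      using fun_cong[OF that, of y] by (simp add: ev_def left_diff_distrib sum_subtractf)
    then have "val (\<lambda>rk. m rk - n rk) = 0" using R[rule_format, of "\<lambda>rk. m rk - n rk"] by (simp only: ev_def val_def)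
    then show ?thesis by (simp add: val_def left_diff_distrib sum_subtractf)
  qed
  \<comment> \<open>By \<open>val_cong\<close> the chosen coefficient vector does not affect the
    value on the module; values elsewhere are arbitrary.\<close>
  define F where "F g = val (SOME m. g = ev m)" for g
  have F_ev: "F (ev m) = val m" for m
  proof -
    have "ev m = ev (SOME n. ev m = ev n)" by (rule someI[where P = "\<lambda>n. ev m = ev n" and x = m, OF refl])
    from val_cong[OF this] show ?thesis by (simp only: F_def)
  qed
  have "F (g + h) = F g + F h" if gh: "g \<in> indicator_module d S" "h \<in> indicator_module d S" for g h
  proof -
    obtain m n where mn: "g = ev m" "h = ev n"
      using gh unfolding indicator_module_def int_span_image_iff[OF assms] ev_def by blast
    have "g + h = ev (\<lambda>rk. m rk + n rk)"
      by (simp add: mn ev_def fun_eq_iff distrib_right sum.distrib)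
    then show ?thesis using mn by (simp add: F_ev) (simp add: val_def distrib_right sum.distrib)
  qed
  moreover have "f rk = F (?Q rk)" if "rk \<in> S" for rk
  proof -
    let ?m = "\<lambda>rk'. of_bool (rk' = rk) :: int"
    have "?Q rk = ev ?m" using that sum_of_bool_singleton(1)[OF assms, of rk "\<lambda>rk'. ?Q rk' y" for y]
      by (intro ext) (simp only: ev_def if_True)
    moreover have "val ?m = f rk"
      using that sum_of_bool_singleton(1)[OF assms, of rk f] by (simp only: val_def of_int_of_bool if_True)
    ultimately show ?thesis using F_ev[of ?m] by simp
  qed
  ultimately show "valuative d S f" unfolding valuative_def by blast
qed

section \<open>Separating a function from a rational span by integer weights\<close>

lemma common_denominator:
  fixes q :: "'a \<Rightarrow> rat"
  assumes "finite S"
  obtains D :: int and m :: "'a \<Rightarrow> int" where "D > 0" and "\<And>x. x \<in> S \<Longrightarrow> of_int (m x) = of_int D * q x"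
proof -
  have "\<exists>D>0. \<forall>x\<in>S. \<exists>k. of_int k = of_int D * q x"
    using assms
  proof (induction S)
    case empty
    show ?case by (rule exI[of _ 1]) simp
  next
    case (insert x S)
    then obtain D where D: "D > 0" "\<And>y. y \<in> S \<Longrightarrow> \<exists>k. of_int k = of_int D * q y" by blast
    obtain a b where ab: "q x = Fract a b" "b > 0" by (rule Rat_cases[of "q x"])
    have "\<exists>k. of_int k = of_int (D * b) * q y" if "y \<in> insert x S" for y
    proof (cases "y = x")
      case True
      then show ?thesis using ab by (intro exI[of _ "D * a"]) (simp add: Fract_of_int_quotient)
    next
      case False
      then obtain k where "of_int k = of_int D * q y" using D(2) \<open>y \<in> insert x S\<close> by blast
      then show ?thesis by (intro exI[of _ "k * b"]) simp
    qed
    moreover have "D * b > 0" using D(1) ab(2) by simp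
    ultimately show ?case by blast
  qed
  then obtain D where "D > 0" "\<forall>x\<in>S. \<exists>k. of_int k = of_int D * q x" by blast
  then show thesis using that[of D] bchoice[of S "\<lambda>x k. of_int k = of_int D * q x"] by blast
qed

lemma vector_space_rat_mult: "vector_space ((*) :: rat \<Rightarrow> rat \<Rightarrow> rat)"
  by unfold_locales (simp_all only: distrib_left distrib_right mult.assoc mult_1_left)

text \<open>A linear functional over the rationals separates \<open>f\<close> from the span. On
  functions supported on the finite set \<open>S\<close> it is a weighted sum, and clearing
  denominators makes the weights integral.\<close>

lemma not_in_span_relation:
  fixes f :: "'a \<Rightarrow> rat" and T :: "('a \<Rightarrow> rat) set"
  assumes fin: "finite S" and T: "\<And>g x. g \<in> T \<Longrightarrow> x \<notin> S \<Longrightarrow> g x = 0" and f: "\<And>x. x \<notin> S \<Longrightarrow> f x = 0"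
    and notin: "f \<notin> rat_fun.span T"
  obtains m :: "'a \<Rightarrow> int" where "\<And>g. g \<in> T \<Longrightarrow> (\<Sum>x\<in>S. of_int (m x) * g x) = 0"
    and "(\<Sum>x\<in>S. of_int (m x) * f x) \<noteq> 0"
proof -
  interpret vp: vector_space_pair "\<lambda>(c::rat) (g::'a \<Rightarrow> rat) x. c * g x" "(*) :: rat \<Rightarrow> rat \<Rightarrow> rat"
    by (intro vector_space_pair.intro rat_fun.vector_space_axioms vector_space_rat_mult)
  obtain B where B: "B \<subseteq> T" "rat_fun.independent B" "T \<subseteq> rat_fun.span B"
    by (rule rat_fun.maximal_independent_subset[of T])
  have "f \<notin> rat_fun.span B" using notin rat_fun.span_mono[OF B(1)] by blast
  then have "rat_fun.independent (insert f B)" using B(2) by (rule rat_fun.independent_insertI)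
  \<comment> \<open>\<open>f\<close> together with a basis of the span of \<open>T\<close> is
    independent, so the functional may be prescribed as 1 at \<open>f\<close> and 0 on that
    basis.\<close>
  from vp.linear_independent_extend[OF this, of "\<lambda>g. if g = f then 1 else 0"]
  obtain \<phi> where lin: "Vector_Spaces.linear (\<lambda>(c::rat) (g::'a \<Rightarrow> rat) x. c * g x) (*) \<phi>"
    and \<phi>: "\<And>g. g \<in> insert f B \<Longrightarrow> \<phi> g = (if g = f then 1 else 0)"
    by (elim exE conjE) (rule that, assumption, erule bspec)
  interpret \<phi>: Vector_Spaces.linear "\<lambda>(c::rat) (g::'a \<Rightarrow> rat) x. c * g x" "(*)" \<phi> by (rule lin)
  \<comment> \<open>The weights are the values of the functional at the point masses.\<close>
  define q where "q x = \<phi> (\<lambda>x'. of_bool (x' = x))" for x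
  have \<phi>_eq: "\<phi> g = (\<Sum>x\<in>S. q x * g x)" if "\<And>x. x \<notin> S \<Longrightarrow> g x = 0" for g
  proof -
    have "g = (\<Sum>x\<in>S. (\<lambda>x'. g x * of_bool (x' = x)))"
    proof
      fix x
      have "(\<Sum>x'\<in>S. (\<lambda>y. g x' * of_bool (y = x'))) x = (if x \<in> S then g x else 0)"
        unfolding fun_sum_apply by (rule sum_of_bool_singleton(2)[OF fin])
      then show "g x = (\<Sum>x'\<in>S. (\<lambda>y. g x' * of_bool (y = x'))) x"
        using that by simp
    qed
    then have "\<phi> g = \<phi> (\<Sum>x\<in>S. (\<lambda>x'. g x * of_bool (x' = x)))" by (rule arg_cong)
    also have "\<dots> = (\<Sum>x\<in>S. g x * q x)" by (simp only: \<phi>.sum \<phi>.scale q_def)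
    finally show ?thesis by (simp add: mult.commute)
  qed
  have \<phi>_T: "\<phi> g = 0" if "g \<in> T" for g
  proof -
    have "g \<in> rat_fun.span B" using B(3) that by blast
    then show ?thesis
    proof (induction rule: rat_fun.span_induct_alt)
      case base
      show ?case by (rule \<phi>.zero)
    next
      case (step c x y)
      moreover have "x \<noteq> f" using step.hyps B(1) notin rat_fun.span_base by blast
      ultimately show ?case using \<phi>[of x] by (simp only: \<phi>.add \<phi>.scale) simp
    qed
  qed
  obtain D m where D: "D > 0" and m: "\<And>x. x \<in> S \<Longrightarrow> of_int (m x) = of_int D * q x"
    using common_denominator[OF fin, of q] by blast
  have m_eq: "(\<Sum>x\<in>S. of_int (m x) * g x) = of_int D * \<phi> g" if "\<And>x. x \<notin> S \<Longrightarrow> g x = 0" for g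
    using \<phi>_eq[OF that] by (simp add: m sum_distrib_left mult.assoc)
  show thesis
  proof
    show "(\<Sum>x\<in>S. of_int (m x) * g x) = 0" if "g \<in> T" for g
      using m_eq[OF T[OF that]] \<phi>_T[OF that] by simp
    show "(\<Sum>x\<in>S. of_int (m x) * f x) \<noteq> 0"
      using m_eq[OF f] \<phi>[of f] D by simp
  qed
qed

section \<open>Maximal chains and permutations\<close>

text \<open>Each strict inclusion adds at least one element; counting up from the empty set and down
  from the ground set squeezes the cardinality.\<close>

lemma maximal_chain_card:
  assumes X: "X \<in> maximal_chains d" and j: "j \<le> d"
  shows "card (X ! j) = j" and "X ! j \<subseteq> {1..d}" and "i \<le> j \<Longrightarrow> X ! i \<subseteq> X ! j"
proof -
  have step: "X ! j \<subset> X ! Suc j" if "Suc j \<le> d" for j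
    using X that by (auto simp: maximal_chains_def dest!: bspec[of _ _ "Suc j"])
  have mono: "X ! i \<subseteq> X ! j" if "i \<le> j" "j \<le> d" for i j
    using that by (induction j rule: dec_induct) (use step in \<open>auto simp: Suc_le_eq dest: less_imp_le\<close>)
  have ends: "X ! 0 = {}" "X ! d = {1..d}" using X by (auto simp: maximal_chains_def)
  have sub: "X ! i \<subseteq> {1..d}" if "i \<le> d" for i using mono[OF that] ends by simp
  have gap: "card (X ! i) + (j - i) \<le> card (X ! j)" if "i \<le> j" "j \<le> d" for i j
    using that
  proof (induction j rule: dec_induct)
    case (step k)
    then have "card (X ! k) < card (X ! Suc k)"
      using \<open>\<And>j. Suc j \<le> d \<Longrightarrow> X ! j \<subset> X ! Suc j\<close>[of k] sub[of "Suc k"]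
      by (intro psubset_card_mono) (auto intro: finite_subset)
    then show ?case using step by simp
  qed simp
  show "card (X ! j) = j" using gap[of 0 j] gap[of j d] ends j by simp
  show "X ! j \<subseteq> {1..d}" by (rule sub[OF j])
  show "X ! i \<subseteq> X ! j" if "i \<le> j" by (rule mono[OF that j])
qed

lemma nth_map_upt_Suc: "j \<le> d \<Longrightarrow> map f [0..<Suc d] ! j = f j"
  by (simp add: less_Suc_eq_le del: upt_Suc)

lemma permutation_chain_in_maximal_chains:
  assumes \<tau>: "\<tau> permutes {1..d}"
  shows "map (\<lambda>j. \<tau> ` {1..j}) [0..<Suc d] \<in> maximal_chains d"
proof -
  have "\<tau> ` {1..j - 1} \<subset> \<tau> ` {1..j}" if "j \<in> {1..d}" for j
  proof -
    have "{1..j - 1} \<subset> {1..j}" using that by auto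
    then show ?thesis using image_strict_mono[OF permutes_inj_on[OF \<tau>]] by blast
  qed
  then have "map (\<lambda>j. \<tau> ` {1..j}) [0..<Suc d] ! (j - 1) \<subset> map (\<lambda>j. \<tau> ` {1..j}) [0..<Suc d] ! j"
    if "j \<in> {1..d}" for j
  proof -
    have "j \<le> d" "j - 1 \<le> d" using that by auto
    then show ?thesis using \<open>\<And>j. j \<in> {1..d} \<Longrightarrow> \<tau> ` {1..j - 1} \<subset> \<tau> ` {1..j}\<close>[OF that]
      by (simp only: nth_map_upt_Suc)
  qed
  then show ?thesis
    unfolding maximal_chains_def using permutes_image[OF \<tau>]
    by (simp add: nth_map_upt_Suc del: upt_Suc)
qed

text \<open>A permutation records the order in which elements enter the chain; it is recovered from
  the differences of consecutive members, and it exists for each chain by refinement.\<close>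

lemma bij_betw_permutations_maximal_chains:
  "bij_betw (\<lambda>\<tau>. map (\<lambda>j. \<tau> ` {1..j}) [0..<Suc d]) {\<tau>. \<tau> permutes {1..d}} (maximal_chains d)"
  unfolding bij_betw_def
proof (intro conjI set_eqI iffI)
  show "inj_on (\<lambda>\<tau>. map (\<lambda>j. \<tau> ` {1..j}) [0..<Suc d]) {\<tau>. \<tau> permutes {1..d}}"
  proof (rule inj_onI)
    fix \<sigma> \<tau> assume "\<sigma> \<in> {\<tau>. \<tau> permutes {1..d}}" "\<tau> \<in> {\<tau>. \<tau> permutes {1..d}}"
      and eq: "map (\<lambda>j. \<sigma> ` {1..j}) [0..<Suc d] = map (\<lambda>j. \<tau> ` {1..j}) [0..<Suc d]"
    then have perm: "\<sigma> permutes {1..d}" "\<tau> permutes {1..d}" by auto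
    have prefix: "\<sigma> ` {1..j} = \<tau> ` {1..j}" if "j \<le> d" for j
      using eq that by (auto simp del: upt_Suc)
    have last: "{\<rho> j} = \<rho> ` {1..j} - \<rho> ` {1..j - 1}" if "j \<in> {1..d}" "\<rho> permutes {1..d}" for \<rho> and j :: nat
    proof -
      have "{1..j} - {1..j - 1} = {j}" using that(1) by auto
      then show ?thesis using image_set_diff[OF permutes_inj[OF that(2)], of "{1..j}" "{1..j - 1}"] by simp
    qed
    show "\<sigma> = \<tau>"
    proof
      fix j
      show "\<sigma> j = \<tau> j"
      proof (cases "j \<in> {1..d}")
        case True
        then have "{\<sigma> j} = {\<tau> j}"
          unfolding last[OF True perm(1)] last[OF True perm(2)]
          by (intro arg_cong2[of _ _ _ _ "(-)"] prefix) auto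
        then show ?thesis by simp
      next
        case False
        then show ?thesis using perm by (simp add: permutes_not_in)
      qed
    qed
  qed
next
  fix X assume "X \<in> (\<lambda>\<tau>. map (\<lambda>j. \<tau> ` {1..j}) [0..<Suc d]) ` {\<tau>. \<tau> permutes {1..d}}"
  then show "X \<in> maximal_chains d" using permutation_chain_in_maximal_chains by blast
next
  fix X assume X: "X \<in> maximal_chains d"
  have len: "length X = Suc d" using X by (simp add: maximal_chains_def)
  have "set X \<in> subset_chains (Pow {1..d})"
    unfolding subset_chains_def
  proof (intro CollectI conjI ballI)
    show "set X \<subseteq> Pow {1..d}"
    proof
      fix A assume "A \<in> set X"
      then obtain j where "j \<le> d" "A = X ! j" using len by (auto simp: in_set_conv_nth less_Suc_eq_le)
      then show "A \<in> Pow {1..d}" using maximal_chain_card(2)[OF X] by simp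
    qed
    fix A B assume "A \<in> set X" "B \<in> set X"
    then obtain i j where "i \<le> d" "A = X ! i" "j \<le> d" "B = X ! j"
      using len by (auto simp: in_set_conv_nth less_Suc_eq_le)
    then show "A \<subseteq> B \<or> B \<subseteq> A"
      using maximal_chain_card(3)[OF X] by (cases "i \<le> j") auto
  qed
  then obtain \<tau> where \<tau>: "\<tau> permutes {1..d}" "\<And>A. A \<in> set X \<Longrightarrow> \<exists>j\<le>d. A = \<tau> ` {1..j}"
    using subset_chain_permutation by blast
  have "X ! j = \<tau> ` {1..j}" if "j \<le> d" for j
  proof -
    have "X ! j \<in> set X" using that len by simp
    \<comment> \<open>Refinement gives some prefix length \<open>k\<close>; comparing cardinalities
      identifies it with \<open>j\<close>.\<close>
    then obtain k where "X ! j = \<tau> ` {1..k}" using \<tau>(2) by blast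
    moreover have "card (\<tau> ` {1..k}) = k" using permutes_inj_on[OF \<tau>(1)] by (simp add: card_image)
    ultimately show ?thesis using maximal_chain_card(1)[OF X that] by simp
  qed
  then have "X = map (\<lambda>j. \<tau> ` {1..j}) [0..<Suc d]"
    using len by (intro nth_equalityI) (auto simp: less_Suc_eq_le simp del: upt_Suc)
  then show "X \<in> (\<lambda>\<tau>. map (\<lambda>j. \<tau> ` {1..j}) [0..<Suc d]) ` {\<tau>. \<tau> permutes {1..d}}"
    using \<tau>(1) by blast
qed

lemma increments_iff_partial_sums:
  fixes u :: "nat \<Rightarrow> nat"
  assumes "u 0 = 0"
  shows "(\<forall>j\<in>{1..d}. int (u j) - int (u (j - 1)) = int (\<alpha> j)) \<longleftrightarrow> (\<forall>j\<le>d. u j = (\<Sum>i=1..j. \<alpha> i))"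
proof (induction d)
  case 0
  show ?case using assms by simp
next
  case (Suc d)
  have "(\<forall>j\<in>{1..Suc d}. int (u j) - int (u (j - 1)) = int (\<alpha> j)) \<longleftrightarrow>
      (\<forall>j\<in>{1..d}. int (u j) - int (u (j - 1)) = int (\<alpha> j)) \<and> int (u (Suc d)) - int (u d) = int (\<alpha> (Suc d))"
    by (auto simp: atLeastAtMostSuc_conv)
  also have "\<dots> \<longleftrightarrow> (\<forall>j\<le>d. u j = (\<Sum>i=1..j. \<alpha> i)) \<and> u (Suc d) = u d + \<alpha> (Suc d)"
  proof -
    have "int (u (Suc d)) - int (u d) = int (\<alpha> (Suc d)) \<longleftrightarrow> u (Suc d) = u d + \<alpha> (Suc d)" by linarith
    then show ?thesis using Suc by (simp only:)
  qed
  also have "\<dots> \<longleftrightarrow> (\<forall>j\<le>Suc d. u j = (\<Sum>i=1..j. \<alpha> i))"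
    by (auto simp: le_Suc_eq)
  finally show ?case .
qed

text \<open>This form splits the count into the single-chain conditions of
  \<open>chain_ranks_relation\<close> and lets relabelling act by composition of
  permutations.\<close>

lemma G_coeff_eq_sum_permutations:
  assumes "rk {} = 0"
  shows "G_coeff d \<alpha> rk =
    (\<Sum>\<tau> | \<tau> permutes {1..d}. of_bool (\<forall>j\<le>d. rk (\<tau> ` {1..j}) = (\<Sum>i=1..j. \<alpha> i)))"
proof -
  let ?X = "\<lambda>\<tau>. map (\<lambda>j. \<tau> ` {1..j}) [0..<Suc d]"
  let ?P = "\<lambda>X. \<forall>j\<in>{1..d}. int (rk (X ! j)) - int (rk (X ! (j - 1))) = int (\<alpha> j)"
  have P: "?P (?X \<tau>) \<longleftrightarrow> (\<forall>j\<le>d. rk (\<tau> ` {1..j}) = (\<Sum>i=1..j. \<alpha> i))" for \<tau>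
  proof -
    have "?P (?X \<tau>) \<longleftrightarrow> (\<forall>j\<in>{1..d}. int (rk (\<tau> ` {1..j})) - int (rk (\<tau> ` {1..j - 1})) = int (\<alpha> j))"
    proof (intro ball_cong refl)
      fix j assume "j \<in> {1..d}"
      then have "j \<le> d" "j - 1 \<le> d" by auto
      then show "int (rk (?X \<tau> ! j)) - int (rk (?X \<tau> ! (j - 1))) = int (\<alpha> j) \<longleftrightarrow>
          int (rk (\<tau> ` {1..j})) - int (rk (\<tau> ` {1..j - 1})) = int (\<alpha> j)"
        by (simp only: nth_map_upt_Suc)
    qed
    then show ?thesis using increments_iff_partial_sums[of "\<lambda>j. rk (\<tau> ` {1..j})" d \<alpha>] assms by simp
  qed
  have "bij_betw ?X {\<tau>\<in>{\<tau>. \<tau> permutes {1..d}}. ?P (?X \<tau>)} {X\<in>maximal_chains d. ?P X}"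
    using bij_betw_permutations_maximal_chains[of d] unfolding bij_betw_def by (auto simp: inj_on_def)
  then have "card {X\<in>maximal_chains d. ?P X} = card {\<tau>\<in>{\<tau>. \<tau> permutes {1..d}}. ?P (?X \<tau>)}"
    by (rule bij_betw_same_card[symmetric])
  moreover have "finite {\<tau>. \<tau> permutes {1..d}}" by (simp add: finite_permutations)
  ultimately show ?thesis
    unfolding G_coeff_def P by (simp add: Int_def)
qed


section \<open>Relabelling the ground set\<close>

definition relabel :: "(nat \<Rightarrow> nat) \<Rightarrow> (nat set \<Rightarrow> nat) \<Rightarrow> nat set \<Rightarrow> nat" where
  "relabel \<sigma> rk = (\<lambda>A. rk (\<sigma> ` A))"

lemma relabel_inv:
  assumes "\<sigma> permutes {1..d}"
  shows "relabel (inv \<sigma>) (relabel \<sigma> rk) = rk" and "relabel \<sigma> (relabel (inv \<sigma>) rk) = rk"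
  using permutes_surj[OF assms] permutes_inj[OF assms]
  by (auto simp: relabel_def fun_eq_iff image_image surj_f_inv_f)

lemma permutes_image_subset_iff:
  assumes "\<sigma> permutes S"
  shows "\<sigma> ` A \<subseteq> S \<longleftrightarrow> A \<subseteq> S"
  using permutes_image[OF assms] permutes_inj[OF assms] by (metis inj_image_subset_iff)

lemma relabel_polymatroids:
  assumes rk: "rk \<in> polymatroids d r" and \<sigma>: "\<sigma> permutes {1..d}"
  shows "relabel \<sigma> rk \<in> polymatroids d r"
proof -
  have pm: "polymatroid d rk" and r: "rk {1..d} = r" using rk by (auto simp: polymatroids_def)
  note sub = permutes_image_subset_iff[OF \<sigma>]
  have "relabel \<sigma> rk \<in> extensional (Pow {1..d})"
    using pm sub by (auto simp: relabel_def polymatroid_def extensional_def)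
  moreover have "relabel \<sigma> rk A \<le> relabel \<sigma> rk B" if "A \<subseteq> B" "B \<subseteq> {1..d}" for A B
    unfolding relabel_def using that sub by (intro polymatroid_mono[OF pm]) auto
  moreover have "relabel \<sigma> rk (A \<union> B) + relabel \<sigma> rk (A \<inter> B) \<le> relabel \<sigma> rk A + relabel \<sigma> rk B"
    if "A \<subseteq> {1..d}" "B \<subseteq> {1..d}" for A B
    using polymatroid_submodular[OF pm, of "\<sigma> ` A" "\<sigma> ` B"] that
    by (simp only: relabel_def image_Un image_Int[OF permutes_inj[OF \<sigma>]] sub)
  ultimately have "polymatroid d (relabel \<sigma> rk)"
    using polymatroid_empty[OF pm] unfolding polymatroid_def by (simp add: relabel_def)
  then show ?thesis using r permutes_image[OF \<sigma>] by (simp add: polymatroids_def relabel_def)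
qed

lemma relabel_matroids:
  assumes rk: "rk \<in> matroids d r" and \<sigma>: "\<sigma> permutes {1..d}"
  shows "relabel \<sigma> rk \<in> matroids d r"
proof -
  have "relabel \<sigma> rk \<in> polymatroids d r"
    using rk by (intro relabel_polymatroids \<sigma>) (simp add: matroids_def matroid_def polymatroids_def)
  moreover have "relabel \<sigma> rk {i} \<le> 1" if "i \<in> {1..d}" for i
    using rk permutes_in_image[OF \<sigma>, of i] that by (simp add: relabel_def matroids_def matroid_def)
  ultimately show ?thesis by (simp add: matroids_def matroid_def polymatroids_def)
qed

text \<open>Relabelling by \<open>\<sigma>\<close> replaces the chain of \<open>\<tau>\<close> by
  that of \<open>\<sigma> \<circ> \<tau>\<close>, which merely reindexes the sum.\<close>

lemma G_coeff_relabel: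
  assumes "rk {} = 0" and \<sigma>: "\<sigma> permutes {1..d}"
  shows "G_coeff d \<alpha> (relabel \<sigma> rk) = G_coeff d \<alpha> rk"
proof -
  have "relabel \<sigma> rk {} = 0" using assms(1) by (simp add: relabel_def)
  have "(\<Sum>\<tau> | \<tau> permutes {1..d}. of_bool (\<forall>j\<le>d. relabel \<sigma> rk (\<tau> ` {1..j}) = (\<Sum>i=1..j. \<alpha> i)) :: rat)
    = (\<Sum>\<tau> | \<tau> permutes {1..d}. of_bool (\<forall>j\<le>d. rk (\<tau> ` {1..j}) = (\<Sum>i=1..j. \<alpha> i)))"
  proof (rule sum.reindex_bij_witness[of _ "\<lambda>\<tau>. inv \<sigma> \<circ> \<tau>" "\<lambda>\<tau>. \<sigma> \<circ> \<tau>"])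
    fix \<tau> assume "\<tau> \<in> {\<tau>. \<tau> permutes {1..d}}"
    then have \<tau>: "\<tau> permutes {1..d}" by simp
    show "inv \<sigma> \<circ> (\<sigma> \<circ> \<tau>) = \<tau>" "\<sigma> \<circ> (inv \<sigma> \<circ> \<tau>) = \<tau>"
      by (simp_all only: o_assoc permutes_inv_o[OF \<sigma>] id_comp)
    show "\<sigma> \<circ> \<tau> \<in> {\<tau>. \<tau> permutes {1..d}}" "inv \<sigma> \<circ> \<tau> \<in> {\<tau>. \<tau> permutes {1..d}}"
      using permutes_compose[OF \<tau> \<sigma>] permutes_compose[OF \<tau> permutes_inv[OF \<sigma>]] by simp_all
    show "of_bool (\<forall>j\<le>d. rk ((\<sigma> \<circ> \<tau>) ` {1..j}) = (\<Sum>i=1..j. \<alpha> i)) =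
      (of_bool (\<forall>j\<le>d. relabel \<sigma> rk (\<tau> ` {1..j}) = (\<Sum>i=1..j. \<alpha> i)) :: rat)"
      by (simp only: relabel_def image_comp)
  qed
  then show ?thesis
    by (simp only: G_coeff_eq_sum_permutations[of rk, OF assms(1)]
        G_coeff_eq_sum_permutations[of "relabel \<sigma> rk", OF \<open>relabel \<sigma> rk {} = 0\<close>])
qed

section \<open>The chain counts are valuative invariants\<close>

text \<open>Working with any family of polymatroids closed under relabelling treats polymatroids and
  matroids together.\<close>

lemma restrict_G_coeff_in_valuative_invariants:
  assumes S: "S \<subseteq> polymatroids d r"
    and closed: "\<And>rk \<sigma>. rk \<in> S \<Longrightarrow> \<sigma> permutes {1..d} \<Longrightarrow> relabel \<sigma> rk \<in> S"
  shows "restrict_zero S (G_coeff d \<alpha>) \<in> valuative_invariants d S"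
proof -
  have fin: "finite S" by (rule finite_subset[OF S finite_polymatroids])
  have empty: "rk {} = 0" if "rk \<in> S" for rk
    using that S polymatroid_empty by (auto simp: polymatroids_def)
  have "valuative d S (restrict_zero S (G_coeff d \<alpha>))"
    unfolding valuative_iff_relations[OF fin]
  proof (intro allI impI)
    fix m :: "(nat set \<Rightarrow> nat) \<Rightarrow> int"
    assume rel: "\<forall>y. (\<Sum>rk\<in>S. m rk * indicator (base_polytope d rk) y) = 0"
    let ?b = "\<lambda>\<tau> rk. \<forall>j\<le>d. rk (\<tau> ` {1..j}) = (\<Sum>i=1..j. \<alpha> i)"
    have "(\<Sum>rk\<in>S. of_int (m rk) * restrict_zero S (G_coeff d \<alpha>) rk) =
        (\<Sum>rk\<in>S. \<Sum>\<tau> | \<tau> permutes {1..d}. of_int (m rk) * of_bool (?b \<tau> rk))"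
      by (intro sum.cong refl) (simp add: restrict_zero_def G_coeff_eq_sum_permutations empty sum_distrib_left)
    \<comment> \<open>After exchanging the sums, each inner sum is a chain relation whose prescribed
      ranks are the partial sums of \<open>\<alpha>\<close>.\<close>
    also have "\<dots> = (\<Sum>\<tau> | \<tau> permutes {1..d}. of_int (\<Sum>rk\<in>S. m rk * of_bool (?b \<tau> rk)))"
      by (subst sum.swap) (simp add: of_int_sum)
    also have "\<dots> = 0"
    proof (rule sum.neutral, rule ballI)
      fix \<tau> assume "\<tau> \<in> {\<tau>. \<tau> permutes {1..d}}"
      then have "(\<Sum>rk\<in>S. m rk * of_bool (?b \<tau> rk)) = 0"
        by (intro chain_ranks_relation[OF fin S]) (use rel in auto)
      then show "of_int (\<Sum>rk\<in>S. m rk * of_bool (?b \<tau> rk)) = (0::rat)" by (simp only: of_int_0)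
    qed
    finally show "(\<Sum>rk\<in>S. of_int (m rk) * restrict_zero S (G_coeff d \<alpha>) rk) = 0" .
  qed
  moreover have "is_invariant d S (restrict_zero S (G_coeff d \<alpha>))"
    unfolding is_invariant_def
  proof (intro ballI allI impI)
    fix rk \<sigma> assume "rk \<in> S" "\<sigma> permutes {1..d}"
    then have "restrict_zero S (G_coeff d \<alpha>) (relabel \<sigma> rk) = restrict_zero S (G_coeff d \<alpha>) rk"
      using closed by (simp add: restrict_zero_def G_coeff_relabel empty)
    then show "restrict_zero S (G_coeff d \<alpha>) (\<lambda>A. rk (\<sigma> ` A)) = restrict_zero S (G_coeff d \<alpha>) rk"
      by (simp only: relabel_def)
  qed
  ultimately show ?thesis by (simp add: valuative_invariants_def restrict_zero_def)
qed

lemma subspace_valuative_invariants: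
  assumes fin: "finite S"
    and closed: "\<And>rk \<sigma>. rk \<in> S \<Longrightarrow> \<sigma> permutes {1..d} \<Longrightarrow> relabel \<sigma> rk \<in> S"
  shows "rat_fun.subspace (valuative_invariants d S)"
  unfolding rat_fun.subspace_def
proof (intro conjI ballI allI)
  show "0 \<in> valuative_invariants d S"
    by (simp add: valuative_invariants_def valuative_iff_relations[OF fin] is_invariant_def)
next
  fix f g assume "f \<in> valuative_invariants d S" "g \<in> valuative_invariants d S"
  then show "f + g \<in> valuative_invariants d S"
    by (simp add: valuative_invariants_def valuative_iff_relations[OF fin] is_invariant_def
        distrib_left sum.distrib)
next
  fix c :: rat and f assume "f \<in> valuative_invariants d S"
  then show "(\<lambda>x. c * f x) \<in> valuative_invariants d S"
    by (simp add: valuative_invariants_def valuative_iff_relations[OF fin] is_invariant_def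
        mult.left_commute[of _ c] flip: sum_distrib_left)
qed

section \<open>From relations along chains back to indicator functions\<close>

text \<open>A predicate that depends only on the rank vector selects a union of fibres of that
  vector, and each fibre has total weight zero.\<close>

lemma sum_predicate_of_ranks:
  fixes n :: "'a \<Rightarrow> int" and w :: "'a \<Rightarrow> nat \<Rightarrow> nat"
  assumes fin: "finite S"
    and rel: "\<And>a. (\<Sum>x\<in>S. n x * of_bool (\<forall>j\<le>d. w x j = a j)) = 0"
    and P: "\<And>x x'. x \<in> S \<Longrightarrow> x' \<in> S \<Longrightarrow> \<forall>j\<le>d. w x j = w x' j \<Longrightarrow> P x \<Longrightarrow> P x'"
  shows "(\<Sum>x\<in>S. n x * of_bool (P x)) = 0"
proof -
  define v where "v x = restrict (w x) {..d}" for x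
  have v_eq: "v x = v x' \<longleftrightarrow> (\<forall>j\<le>d. w x j = w x' j)" for x x'
    by (auto simp: v_def fun_eq_iff restrict_def)
  let ?T = "{x\<in>S. P x}"
  have "(\<Sum>x\<in>S. n x * of_bool (P x)) = (\<Sum>x\<in>?T. n x)"
    using fin by (simp add: Int_def)
  also have "\<dots> = (\<Sum>b\<in>v ` ?T. \<Sum>x\<in>{x\<in>?T. v x = b}. n x)"
    using fin by (intro sum.image_gen) simp
  also have "\<dots> = 0"
  proof (rule sum.neutral, rule ballI)
    fix b assume "b \<in> v ` ?T"
    then obtain x0 where x0: "x0 \<in> S" "P x0" "b = v x0" by blast
    have "{x\<in>?T. v x = b} = {x\<in>S. \<forall>j\<le>d. w x j = w x0 j}"
      using P[OF x0(1)] x0 by (auto simp: v_eq)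
    then show "(\<Sum>x\<in>{x\<in>?T. v x = b}. n x) = 0"
      using rel[of "w x0"] fin by (simp add: Int_def)
  qed
  finally show ?thesis .
qed

text \<open>The converse of \<open>chain_ranks_relation\<close>. In the expansion by chains of
  violated inequalities, each term depends only on the ranks along a complete flag refining its
  chain.\<close>

lemma base_polytope_relation_if_chain_relations:
  fixes n :: "(nat set \<Rightarrow> nat) \<Rightarrow> int"
  assumes S: "S \<subseteq> polymatroids d r"
    and rel: "\<And>\<tau> a. \<tau> permutes {1..d} \<Longrightarrow>
      (\<Sum>rk\<in>S. n rk * of_bool (\<forall>j\<le>d. rk (\<tau> ` {1..j}) = a j)) = 0"
  shows "(\<Sum>rk\<in>S. n rk * indicator (base_polytope d rk) y) = 0"
proof (cases "y \<in> {1..d} \<rightarrow>\<^sub>E UNIV \<and> (\<Sum>i\<in>{1..d}. y i) = real r")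
  case False
  \<comment> \<open>The expansion requires \<open>y\<close> to have coordinate sum \<open>r\<close>;
    elsewhere all terms vanish because every member of \<open>S\<close> has rank
    \<open>r\<close>.\<close>
  then show ?thesis
    using S by (intro sum.neutral) (auto simp: base_polytope_def polymatroids_def indicator_def)
next
  case True
  have fin: "finite S" by (rule finite_subset[OF S finite_polymatroids])
  have "(\<Sum>rk\<in>S. n rk * indicator (base_polytope d rk) y) =
      (\<Sum>rk\<in>S. \<Sum>C\<in>subset_chains (Pow {1..d}).
         (-1) ^ card C * (n rk * of_bool (\<forall>A\<in>C. real (rk A) < sum y A)))"
  proof (rule sum.cong[OF refl])
    fix rk assume "rk \<in> S"
    then have "polymatroid d rk" "rk {1..d} = r" using S by (auto simp: polymatroids_def)
    then show "n rk * indicator (base_polytope d rk) y = (\<Sum>C\<in>subset_chains (Pow {1..d}).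
         (-1) ^ card C * (n rk * of_bool (\<forall>A\<in>C. real (rk A) < sum y A)))"
      using indicator_base_polytope[of d rk y] True
      by (simp only: sum_distrib_left mult.left_commute)
  qed
  also have "\<dots> = (\<Sum>C\<in>subset_chains (Pow {1..d}).
       (-1) ^ card C * (\<Sum>rk\<in>S. n rk * of_bool (\<forall>A\<in>C. real (rk A) < sum y A)))"
    unfolding sum_distrib_left by (rule sum.swap)
  also have "\<dots> = 0"
  proof (rule sum.neutral, rule ballI)
    fix C assume C: "C \<in> subset_chains (Pow {1..d})"
    obtain \<tau> where \<tau>: "\<tau> permutes {1..d}" "\<And>A. A \<in> C \<Longrightarrow> \<exists>j\<le>d. A = \<tau> ` {1..j}"
      using subset_chain_permutation[OF C] by blast
    have "(\<Sum>rk\<in>S. n rk * of_bool (\<forall>A\<in>C. real (rk A) < sum y A)) = 0"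
    proof (rule sum_predicate_of_ranks[OF fin rel[OF \<tau>(1)]])
      fix rk rk' :: "nat set \<Rightarrow> nat"
      assume eq: "\<forall>j\<le>d. rk (\<tau> ` {1..j}) = rk' (\<tau> ` {1..j})"
        and lt: "\<forall>A\<in>C. real (rk A) < sum y A"
      show "\<forall>A\<in>C. real (rk' A) < sum y A"
      proof
        fix A assume "A \<in> C"
        then have "rk A = rk' A" using \<tau>(2)[OF \<open>A \<in> C\<close>] eq by auto
        then show "real (rk' A) < sum y A" using lt \<open>A \<in> C\<close> by auto
      qed
    qed
    then show "(-1) ^ card C * (\<Sum>rk\<in>S. n rk * of_bool (\<forall>A\<in>C. real (rk A) < sum y A)) = 0" by simp
  qed
  finally show ?thesis .
qed

section \<open>The chain counts span all valuative invariants\<close>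

lemma composition_of_chain:
  assumes rk: "rk \<in> polymatroids d r" and \<tau>: "\<tau> permutes {1..d}"
  obtains \<alpha> where "\<alpha> \<in> weak_compositions d r"
    and "\<And>j. j \<le> d \<Longrightarrow> rk (\<tau> ` {1..j}) = (\<Sum>i=1..j. \<alpha> i)"
proof -
  have pm: "polymatroid d rk" and r: "rk {1..d} = r" using rk by (auto simp: polymatroids_def)
  \<comment> \<open>Monotonicity of the rank makes the truncated subtraction exact.\<close>
  define \<alpha> where "\<alpha> = (\<lambda>j\<in>{1..d}. rk (\<tau> ` {1..j}) - rk (\<tau> ` {1..j - 1}))"
  have "rk (\<tau> ` {1..j}) = (\<Sum>i=1..j. \<alpha> i)" if "j \<le> d" for j
    using that
  proof (induction j)
    case 0
    then show ?case using polymatroid_empty[OF pm] by simp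
  next
    case (Suc j)
    have "\<tau> ` {1..Suc j} \<subseteq> {1..d}"
      using image_mono[of "{1..Suc j}" "{1..d}" \<tau>] permutes_image[OF \<tau>] Suc.prems by simp
    then have "rk (\<tau> ` {1..j}) \<le> rk (\<tau> ` {1..Suc j})"
      by (intro polymatroid_mono[OF pm]) auto
    moreover have "\<alpha> (Suc j) = rk (\<tau> ` {1..Suc j}) - rk (\<tau> ` {1..j})"
      using Suc.prems by (simp add: \<alpha>_def)
    ultimately show ?case using Suc by simp
  qed
  moreover from this[of d] have "\<alpha> \<in> weak_compositions d r"
    using r permutes_image[OF \<tau>] by (simp add: weak_compositions_def \<alpha>_def)
  ultimately show thesis using that by blast
qed

lemma span_G_coeff:
  assumes S: "S \<subseteq> polymatroids d r"
    and closed: "\<And>rk \<sigma>. rk \<in> S \<Longrightarrow> \<sigma> permutes {1..d} \<Longrightarrow> relabel \<sigma> rk \<in> S"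
  shows "rat_fun.span ((\<lambda>\<alpha>. restrict_zero S (G_coeff d \<alpha>)) ` weak_compositions d r) = valuative_invariants d S"
    (is "rat_fun.span ?T = _")
proof (rule equalityI)
  have fin: "finite S" by (rule finite_subset[OF S finite_polymatroids])
  show "rat_fun.span ?T \<subseteq> valuative_invariants d S"
    using restrict_G_coeff_in_valuative_invariants[OF S closed]
    by (intro rat_fun.span_minimal subspace_valuative_invariants fin closed) auto
  show "valuative_invariants d S \<subseteq> rat_fun.span ?T"
  proof (rule subsetI, rule ccontr)
    fix f assume f: "f \<in> valuative_invariants d S" and notin: "f \<notin> rat_fun.span ?T"
    have "g rk = 0" if "g \<in> ?T" "rk \<notin> S" for g rk using that by (auto simp: restrict_zero_def)
    moreover have "f rk = 0" if "rk \<notin> S" for rk using f that by (simp add: valuative_invariants_def)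
    ultimately obtain m :: "(nat set \<Rightarrow> nat) \<Rightarrow> int"
      where m_T: "\<And>g. g \<in> ?T \<Longrightarrow> (\<Sum>rk\<in>S. of_int (m rk) * g rk) = 0"
        and m_f: "(\<Sum>rk\<in>S. of_int (m rk) * f rk) \<noteq> 0"
      using not_in_span_relation[OF fin _ _ notin] by blast
    \<comment> \<open>Symmetrising the relation \<open>m\<close> leaves its value on the invariant \<open>f\<close> unchanged up to the
      factor \<open>d!\<close>, and turns relations between the chain counts \<open>G_coeff\<close> into relations for each
      single chain.\<close>
    let ?P = "{\<sigma>. \<sigma> permutes {1..d}}"
    have finP: "finite ?P" by (simp add: finite_permutations)
    define n where "n rk = (\<Sum>\<sigma>\<in>?P. m (relabel \<sigma> rk))" for rk
    have bij: "bij_betw (relabel \<sigma>) S S" if "\<sigma> \<in> ?P" for \<sigma>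
    proof -
      have \<sigma>: "\<sigma> permutes {1..d}" using that by simp
      show ?thesis
        by (rule bij_betw_byWitness[where f' = "relabel (inv \<sigma>)"])
          (use relabel_inv[OF \<sigma>] closed \<sigma> permutes_inv[OF \<sigma>] in auto)
    qed
    \<comment> \<open>Since relabelling permutes \<open>S\<close>, the averaging can be moved from
      the weights to the test function.\<close>
    have transfer: "(\<Sum>rk\<in>S. of_int (n rk) * g rk) =
        (\<Sum>rk\<in>S. of_int (m rk) * (\<Sum>\<sigma>\<in>?P. g (relabel (inv \<sigma>) rk)))" for g :: "_ \<Rightarrow> rat"
    proof -
      have "(\<Sum>rk\<in>S. of_int (n rk) * g rk) = (\<Sum>\<sigma>\<in>?P. \<Sum>rk\<in>S. of_int (m (relabel \<sigma> rk)) * g rk)"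
        unfolding n_def of_int_sum sum_distrib_right by (rule sum.swap)
      also have "\<dots> = (\<Sum>\<sigma>\<in>?P. \<Sum>rk\<in>S. of_int (m rk) * g (relabel (inv \<sigma>) rk))"
      proof (rule sum.cong[OF refl])
        fix \<sigma> assume \<sigma>: "\<sigma> \<in> ?P"
        have "(\<Sum>rk\<in>S. of_int (m rk) * g (relabel (inv \<sigma>) rk)) =
            (\<Sum>rk\<in>S. of_int (m (relabel \<sigma> rk)) * g (relabel (inv \<sigma>) (relabel \<sigma> rk)))"
          by (rule sum.reindex_bij_betw[OF bij[OF \<sigma>], symmetric])
        then show "(\<Sum>rk\<in>S. of_int (m (relabel \<sigma> rk)) * g rk) =
            (\<Sum>rk\<in>S. of_int (m rk) * g (relabel (inv \<sigma>) rk))"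
          using \<sigma> relabel_inv(1)[of \<sigma> d] by simp
      qed
      also have "\<dots> = (\<Sum>rk\<in>S. of_int (m rk) * (\<Sum>\<sigma>\<in>?P. g (relabel (inv \<sigma>) rk)))"
        unfolding sum_distrib_left by (rule sum.swap)
      finally show ?thesis .
    qed
    have chain: "(\<Sum>rk\<in>S. n rk * of_bool (\<forall>j\<le>d. rk (\<tau> ` {1..j}) = a j)) = 0"
      if \<tau>: "\<tau> permutes {1..d}" for \<tau> a
    \<comment> \<open>Either no member of \<open>S\<close> attains the prescribed ranks and all
      terms vanish, or they are partial sums of a weak composition of \<open>r\<close>, so that the
      matching chain count lies in the spanning set.\<close>
    proof (cases "\<exists>rk\<in>S. \<forall>j\<le>d. rk (\<tau> ` {1..j}) = a j")
      case False
      then show ?thesis by (intro sum.neutral) auto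
    next
      case True
      then obtain rk0 where rk0: "rk0 \<in> S" "\<And>j. j \<le> d \<Longrightarrow> rk0 (\<tau> ` {1..j}) = a j" by blast
      have "rk0 \<in> polymatroids d r" using rk0(1) S by blast
      from composition_of_chain[OF this \<tau>] obtain \<alpha> where \<alpha>: "\<alpha> \<in> weak_compositions d r"
        "\<And>j. j \<le> d \<Longrightarrow> rk0 (\<tau> ` {1..j}) = (\<Sum>i=1..j. \<alpha> i)" by blast
      have a: "a j = (\<Sum>i=1..j. \<alpha> i)" if "j \<le> d" for j using rk0(2)[OF that] \<alpha>(2)[OF that] by simp
      let ?b = "\<lambda>\<tau> rk. of_bool (\<forall>j\<le>d. rk (\<tau> ` {1..j}) = (\<Sum>i=1..j. \<alpha> i)) :: rat"
      have "(\<Sum>\<sigma>\<in>?P. ?b \<tau> (relabel (inv \<sigma>) rk)) = restrict_zero S (G_coeff d \<alpha>) rk" if "rk \<in> S" for rk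
      proof -
        have "rk {} = 0" using that S polymatroid_empty by (auto simp: polymatroids_def)
        \<comment> \<open>For fixed \<open>\<tau>\<close>, the product
          \<open>inv \<sigma> \<circ> \<tau>\<close> runs once through all permutations, so
          averaging the condition on one chain yields the count over all chains.\<close>
        have "(\<Sum>\<sigma>\<in>?P. ?b \<tau> (relabel (inv \<sigma>) rk)) = (\<Sum>\<rho>\<in>?P. ?b \<rho> rk)"
        proof (rule sum.reindex_bij_witness[of _ "\<lambda>\<rho>. \<tau> \<circ> inv \<rho>" "\<lambda>\<sigma>. inv \<sigma> \<circ> \<tau>"])
          fix \<sigma> assume "\<sigma> \<in> ?P"
          then have \<sigma>: "\<sigma> permutes {1..d}" by simp
          show "\<tau> \<circ> inv (inv \<sigma> \<circ> \<tau>) = \<sigma>"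
            using permutes_bij[OF \<sigma>] permutes_bij[OF \<tau>]
            by (simp add: o_inv_distrib bij_imp_bij_inv inv_inv_eq o_assoc permutes_inv_o[OF \<tau>])
          show "inv (\<tau> \<circ> inv \<sigma>) \<circ> \<tau> = \<sigma>"
            using permutes_bij[OF \<sigma>] permutes_bij[OF \<tau>]
            by (simp add: o_inv_distrib bij_imp_bij_inv inv_inv_eq permutes_inv_o[OF \<tau>] flip: o_assoc)
          show "inv \<sigma> \<circ> \<tau> \<in> ?P" "\<tau> \<circ> inv \<sigma> \<in> ?P"
            using permutes_compose[OF \<tau> permutes_inv[OF \<sigma>]] permutes_compose[OF permutes_inv[OF \<sigma>] \<tau>] by simp_all
          show "?b (inv \<sigma> \<circ> \<tau>) rk = ?b \<tau> (relabel (inv \<sigma>) rk)"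
            by (simp only: relabel_def image_comp)
        qed
        then show ?thesis
          using that by (simp only: restrict_zero_def G_coeff_eq_sum_permutations[of rk, OF \<open>rk {} = 0\<close>] if_True)
      qed
      then have "(\<Sum>rk\<in>S. of_int (n rk) * ?b \<tau> rk) = (\<Sum>rk\<in>S. of_int (m rk) * restrict_zero S (G_coeff d \<alpha>) rk)"
        unfolding transfer by simp
      also have "\<dots> = 0" using \<alpha>(1) by (intro m_T) simp
      finally have "of_int (\<Sum>rk\<in>S. n rk * of_bool (\<forall>j\<le>d. rk (\<tau> ` {1..j}) = (\<Sum>i=1..j. \<alpha> i))) = (0::rat)"
        by (simp only: of_int_sum of_int_mult of_int_of_bool)
      moreover have "(\<forall>j\<le>d. rk (\<tau> ` {1..j}) = a j) \<longleftrightarrow> (\<forall>j\<le>d. rk (\<tau> ` {1..j}) = (\<Sum>i=1..j. \<alpha> i))" for rk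
        using a by simp
      ultimately show ?thesis by (simp only: of_int_eq_0_iff)
    qed
    have "(\<Sum>rk\<in>S. n rk * indicator (base_polytope d rk) y) = 0" for y
      by (rule base_polytope_relation_if_chain_relations[OF S chain])
    then have n_f: "(\<Sum>rk\<in>S. of_int (n rk) * f rk) = 0"
      using f unfolding valuative_invariants_def valuative_iff_relations[OF fin] by blast
    have "f (relabel (inv \<sigma>) rk) = f rk" if "rk \<in> S" "\<sigma> \<in> ?P" for \<sigma> rk
      using f that permutes_inv[of \<sigma>] by (simp add: valuative_invariants_def is_invariant_def relabel_def)
    then have "(\<Sum>rk\<in>S. of_int (n rk) * f rk) = of_nat (card ?P) * (\<Sum>rk\<in>S. of_int (m rk) * f rk)"
      unfolding transfer by (simp add: sum_distrib_left mult.left_commute)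
    moreover have "id \<in> ?P" by (simp add: permutes_id)
    then have "card ?P \<noteq> 0" using finP by (simp only: card_eq_0_iff) blast
    ultimately show False using n_f m_f by simp
  qed
qed

theorem theorem1p3:
  fixes d r :: nat
  shows "rat_fun.span ((\<lambda>\<alpha>. restrict_zero (polymatroids d r) (G_coeff d \<alpha>)) ` weak_compositions d r)
           = valuative_invariants d (polymatroids d r)
       \<and> rat_fun.span ((\<lambda>\<alpha>. restrict_zero (matroids d r) (G_coeff d \<alpha>)) ` weak_compositions d r)
           = valuative_invariants d (matroids d r)"
proof
  show "rat_fun.span ((\<lambda>\<alpha>. restrict_zero (polymatroids d r) (G_coeff d \<alpha>)) ` weak_compositions d r)
           = valuative_invariants d (polymatroids d r)"
    by (rule span_G_coeff[OF subset_refl]) (rule relabel_polymatroids)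
  have "matroids d r \<subseteq> polymatroids d r" by (auto simp: matroids_def matroid_def polymatroids_def)
  then show "rat_fun.span ((\<lambda>\<alpha>. restrict_zero (matroids d r) (G_coeff d \<alpha>)) ` weak_compositions d r)
           = valuative_invariants d (matroids d r)"
    by (rule span_G_coeff) (rule relabel_matroids)
qed

end
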